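(* Let $(R,\mathfrak m)$ be a Noetherian local ring of dimension one with infinite residue field. Then $R$ is Cohen-Macaulay if and only if $\tau_{\mathcal I} = \mathfrak f_R$; otherwise (i.e. if $R$ is not Cohen-Macaulay) $\mathfrak f_R=R$ and $\tau_{\mathcal I}$ is a proper ideal of $R$.
   Context: All rings are commutative with identity. For a Noetherian local ring $R$, $\tau_{\mathcal I} := \bigcap_{I} (I:\bar I)$, the intersection over all ideals $I$ of $R$, where $\bar I$ is the usual integral closure of the ideal $I$ and $(I:\bar I)=\{r\in R: r\bar I\subseteq I\}$. The conductor of a Noetherian ring $R$ is the ideal $\mathfrak f_R := (R:_R \bar R)=\{r\in R: r\bar R\subseteq R\}$, where $\bar R$ is the integral closure of $R$ in its total ring of fractions (the localization of $R$ at the set of all non-zerodivisors). *)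

theory Defs
  imports "HOL-Algebra.Algebra" "HOL-Library.Extended_Nat"
begin

locale noetherian_local_ring = cring R + noetherian_ring R + maximalideal \<mm> R
  for R (structure) and \<mm> +
  assumes unique_maximal: "maximalideal \<nn> R \<Longrightarrow> \<nn> = \<mm>"

text \<open>
  Supremum of the lengths \<open>n\<close> of strict chains \<open>P 0 \<subset> \<dots> \<subset> P n\<close> of prime ideals.  For the zero
  ring, which has no primes, this yields \<open>0\<close>; a local ring is never zero.
\<close>
definition krull_dim :: "('a, 'b) ring_scheme \<Rightarrow> enat" where
  "krull_dim R = Sup {enat n | n. \<exists>P :: nat \<Rightarrow> 'a set.
     (\<forall>i\<le>n. primeideal (P i) R) \<and> (\<forall>i<n. P i \<subset> P (Suc i))}"

definition nonzerodivisors :: "('a, 'b) ring_scheme \<Rightarrow> 'a set" where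
  "nonzerodivisors R =
     {s \<in> carrier R. \<forall>r \<in> carrier R. s \<otimes>\<^bsub>R\<^esub> r = \<zero>\<^bsub>R\<^esub> \<longrightarrow> r = \<zero>\<^bsub>R\<^esub>}"

text \<open>
  A list \<open>x\<^sub>0, \<dots>, x\<^sub>n\<close> is \<open>R\<close>-regular if the class of each \<open>x\<^sub>i\<close> is a nonzerodivisor of
  \<open>R/(x\<^sub>0, \<dots>, x\<^sub>i\<^sub>-\<^sub>1)\<close> and \<open>(x\<^sub>0, \<dots>, x\<^sub>n) \<noteq> R\<close>.  The empty list has quotient \<open>R/(0)\<close>.
\<close>
definition regular_sequence :: "('a, 'b) ring_scheme \<Rightarrow> 'a list \<Rightarrow> bool" where
  "regular_sequence R xs \<longleftrightarrow>
     set xs \<subseteq> carrier R \<and>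
     (\<forall>i < length xs.
        (Idl\<^bsub>R\<^esub> (set (take i xs))) +>\<^bsub>R\<^esub> (xs ! i)
          \<in> nonzerodivisors (R Quot (Idl\<^bsub>R\<^esub> (set (take i xs))))) \<and>
     Idl\<^bsub>R\<^esub> (set xs) \<noteq> carrier R"

definition local_depth :: "('a, 'b) ring_scheme \<Rightarrow> 'a set \<Rightarrow> enat" where
  "local_depth R \<mm> = Sup {enat (length xs) | xs. regular_sequence R xs \<and> set xs \<subseteq> \<mm>}"

definition cohen_macaulay_local :: "('a, 'b) ring_scheme \<Rightarrow> 'a set \<Rightarrow> bool" where
  "cohen_macaulay_local R \<mm> \<longleftrightarrow> noetherian_local_ring R \<mm> \<and> local_depth R \<mm> = krull_dim R"

text \<open>
  \<open>x\<close> is integral over \<open>I\<close> if \<open>x\<^sup>n + a\<^sub>1 x\<^sup>n\<^sup>-\<^sup>1 + \<dots> + a\<^sub>n = 0\<close> for some \<open>n \<ge> 1\<close> and \<open>a\<^sub>i \<in> I\<^sup>i\<close>,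
  where \<open>I\<^sup>i\<close> is the power in the multiplicative monoid of ideals.
\<close>
definition ideal_integral_closure :: "('a, 'b) ring_scheme \<Rightarrow> 'a set \<Rightarrow> 'a set" where
  "ideal_integral_closure R I = {x \<in> carrier R. \<exists>n\<ge>1::nat. \<exists>a :: nat \<Rightarrow> 'a.
     (\<forall>i\<in>{1..n}. a i \<in> I [^]\<^bsub>ideals_set R\<^esub> i) \<and>
     x [^]\<^bsub>R\<^esub> n \<oplus>\<^bsub>R\<^esub> (\<Oplus>\<^bsub>R\<^esub>i\<in>{1..n}. a i \<otimes>\<^bsub>R\<^esub> x [^]\<^bsub>R\<^esub> (n - i)) = \<zero>\<^bsub>R\<^esub>}"

definition ideal_colon :: "('a, 'b) ring_scheme \<Rightarrow> 'a set \<Rightarrow> 'a set \<Rightarrow> 'a set" where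
  "ideal_colon R I J = {r \<in> carrier R. \<forall>x\<in>J. r \<otimes>\<^bsub>R\<^esub> x \<in> I}"

definition tau_ideal :: "('a, 'b) ring_scheme \<Rightarrow> 'a set" where
  "tau_ideal R = (\<Inter>I \<in> {I. ideal I R}. ideal_colon R I (ideal_integral_closure R I))"

definition loc_rel ::
  "('a, 'b) ring_scheme \<Rightarrow> 'a set \<Rightarrow> (('a \<times> 'a) \<times> ('a \<times> 'a)) set" where
  "loc_rel R S = {((r, s), (r', s')).
     r \<in> carrier R \<and> r' \<in> carrier R \<and> s \<in> S \<and> s' \<in> S \<and>
     (\<exists>t\<in>S. t \<otimes>\<^bsub>R\<^esub> (r \<otimes>\<^bsub>R\<^esub> s') = t \<otimes>\<^bsub>R\<^esub> (r' \<otimes>\<^bsub>R\<^esub> s))}"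

definition loc_frac :: "('a, 'b) ring_scheme \<Rightarrow> 'a set \<Rightarrow> 'a \<Rightarrow> 'a \<Rightarrow> ('a \<times> 'a) set" where
  "loc_frac R S r s = loc_rel R S `` {(r, s)}"

text \<open>
  The operations are defined on classes as unions over all representatives; these unions are
  single classes by the lemmas \<open>loc_add_frac\<close> and \<open>loc_mult_frac\<close> below.
\<close>
definition localization :: "('a, 'b) ring_scheme \<Rightarrow> 'a set \<Rightarrow> ('a \<times> 'a) set ring" where
  "localization R S =
     \<lparr>carrier = (carrier R \<times> S) // loc_rel R S,
      monoid.mult = (\<lambda>U V. \<Union>(r, s)\<in>U. \<Union>(r', s')\<in>V.
                loc_frac R S (r \<otimes>\<^bsub>R\<^esub> r') (s \<otimes>\<^bsub>R\<^esub> s')),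
      one = loc_frac R S \<one>\<^bsub>R\<^esub> \<one>\<^bsub>R\<^esub>,
      ring.zero = loc_frac R S \<zero>\<^bsub>R\<^esub> \<one>\<^bsub>R\<^esub>,
      ring.add = (\<lambda>U V. \<Union>(r, s)\<in>U. \<Union>(r', s')\<in>V.
                loc_frac R S (r \<otimes>\<^bsub>R\<^esub> s' \<oplus>\<^bsub>R\<^esub> r' \<otimes>\<^bsub>R\<^esub> s) (s \<otimes>\<^bsub>R\<^esub> s'))\<rparr>"

definition total_fractions :: "('a, 'b) ring_scheme \<Rightarrow> ('a \<times> 'a) set ring" where
  "total_fractions R = localization R (nonzerodivisors R)"

definition to_fractions :: "('a, 'b) ring_scheme \<Rightarrow> 'a \<Rightarrow> ('a \<times> 'a) set" where
  "to_fractions R r = loc_frac R (nonzerodivisors R) r \<one>\<^bsub>R\<^esub>"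

text \<open>Here \<open>K\<close> is meant to be a subring of \<open>A\<close>.\<close>
definition integral_closure_in :: "('a, 'b) ring_scheme \<Rightarrow> 'a set \<Rightarrow> 'a set" where
  "integral_closure_in A K = {x \<in> carrier A. \<exists>n\<ge>1::nat. \<exists>a :: nat \<Rightarrow> 'a.
     (\<forall>i\<in>{1..n}. a i \<in> K) \<and>
     x [^]\<^bsub>A\<^esub> n \<oplus>\<^bsub>A\<^esub> (\<Oplus>\<^bsub>A\<^esub>i\<in>{1..n}. a i \<otimes>\<^bsub>A\<^esub> x [^]\<^bsub>A\<^esub> (n - i)) = \<zero>\<^bsub>A\<^esub>}"

text \<open>\<open>R\<close> is identified with its (isomorphic) image in its total ring of fractions.\<close>
definition ring_integral_closure :: "('a, 'b) ring_scheme \<Rightarrow> ('a \<times> 'a) set set" where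
  "ring_integral_closure R =
     integral_closure_in (total_fractions R) (to_fractions R ` carrier R)"

definition conductor :: "('a, 'b) ring_scheme \<Rightarrow> 'a set" where
  "conductor R = {r \<in> carrier R. \<forall>x \<in> ring_integral_closure R.
     to_fractions R r \<otimes>\<^bsub>total_fractions R\<^esub> x \<in> to_fractions R ` carrier R}"

locale mult_subset = cring R for R (structure) +
  fixes S
  assumes S_sub: "S \<subseteq> carrier R"
    and S_one: "\<one> \<in> S"
    and S_mult: "\<lbrakk>s \<in> S; t \<in> S\<rbrakk> \<Longrightarrow> s \<otimes> t \<in> S"
begin

lemma S_carr [simp]: "s \<in> S \<Longrightarrow> s \<in> carrier R"
  using S_sub by blast

lemma loc_rel_equiv: "equiv (carrier R \<times> S) (loc_rel R S)"
proof (rule equivI)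
  show "loc_rel R S \<subseteq> (carrier R \<times> S) \<times> (carrier R \<times> S)"
    unfolding loc_rel_def by auto
  show "refl_on (carrier R \<times> S) (loc_rel R S)"
    using S_one by (auto simp: refl_on_def loc_rel_def)
  show "sym (loc_rel R S)"
  proof (rule symI, clarify)
    fix a s b t assume "((a, s), (b, t)) \<in> loc_rel R S"
    then show "((b, t), (a, s)) \<in> loc_rel R S"
      unfolding loc_rel_def by (simp, metis)
  qed
  show "trans (loc_rel R S)"
  proof (rule transI, clarify)
    fix a s b t c u
    assume 1: "((a, s), (b, t)) \<in> loc_rel R S" and 2: "((b, t), (c, u)) \<in> loc_rel R S"
    from 1 obtain p where p: "a \<in> carrier R" "b \<in> carrier R" "s \<in> S" "t \<in> S" "p \<in> S"
      "p \<otimes> (a \<otimes> t) = p \<otimes> (b \<otimes> s)" unfolding loc_rel_def by auto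
    from 2 obtain q where q: "c \<in> carrier R" "u \<in> S" "q \<in> S"
      "q \<otimes> (b \<otimes> u) = q \<otimes> (c \<otimes> t)" unfolding loc_rel_def by auto
    have "(p \<otimes> q \<otimes> t) \<otimes> (a \<otimes> u) = (q \<otimes> u) \<otimes> (p \<otimes> (a \<otimes> t))"
      using p(1-5) q(1-3) by (simp add: m_ac)
    also have "\<dots> = (p \<otimes> s) \<otimes> (q \<otimes> (b \<otimes> u))"
      unfolding p(6) using p(1-5) q(1-3) by (simp add: m_ac)
    also have "\<dots> = (p \<otimes> q \<otimes> t) \<otimes> (c \<otimes> s)"
      unfolding q(4) using p(1-5) q(1-3) by (simp add: m_ac)
    finally show "((a, s), (c, u)) \<in> loc_rel R S"
      unfolding loc_rel_def using p(1-5) q(1-3) S_mult by blast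
  qed
qed

lemma loc_frac_eq_iff:
  assumes "a \<in> carrier R" "s \<in> S" "b \<in> carrier R" "t \<in> S"
  shows "loc_frac R S a s = loc_frac R S b t \<longleftrightarrow> (\<exists>u\<in>S. u \<otimes> (a \<otimes> t) = u \<otimes> (b \<otimes> s))"
  unfolding loc_frac_def
  using eq_equiv_class_iff[OF loc_rel_equiv, of "(a, s)" "(b, t)"] assms
  by (auto simp: loc_rel_def)

lemma loc_frac_eqI':
  assumes "u \<in> S" "a \<in> carrier R" "s \<in> S" "b \<in> carrier R" "t \<in> S"
    and "u \<otimes> (a \<otimes> t) = u \<otimes> (b \<otimes> s)"
  shows "loc_frac R S a s = loc_frac R S b t"
  using loc_frac_eq_iff[OF assms(2-5)] assms(1,6) by blast

lemma loc_frac_eqI: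
  assumes "a \<in> carrier R" "s \<in> S" "b \<in> carrier R" "t \<in> S" "a \<otimes> t = b \<otimes> s"
  shows "loc_frac R S a s = loc_frac R S b t"
  using loc_frac_eq_iff[OF assms(1-4)] assms(5) S_one by auto

lemma loc_frac_closed [simp]:
  "\<lbrakk>a \<in> carrier R; s \<in> S\<rbrakk> \<Longrightarrow> loc_frac R S a s \<in> carrier (localization R S)"
  unfolding localization_def loc_frac_def by (auto intro: quotientI)

lemma loc_cases:
  assumes "U \<in> carrier (localization R S)"
  obtains a s where "a \<in> carrier R" "s \<in> S" "U = loc_frac R S a s"
  using assms unfolding localization_def loc_frac_def by (auto elim!: quotientE)

lemma loc_mult_frac:
  assumes "a \<in> carrier R" "s \<in> S" "b \<in> carrier R" "t \<in> S"
  shows "loc_frac R S a s \<otimes>\<^bsub>localization R S\<^esub> loc_frac R S b t = loc_frac R S (a \<otimes> b) (s \<otimes> t)"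
proof -
  let ?f = "\<lambda>(r, s). \<lambda>(r', s'). loc_frac R S (r \<otimes> r') (s \<otimes> s')"
  have "congruent2 (loc_rel R S) (loc_rel R S) ?f"
  proof (rule congruent2I'; clarify)
    fix a s a' s' b t b' t'
    assume 1: "((a, s), (a', s')) \<in> loc_rel R S" and 2: "((b, t), (b', t')) \<in> loc_rel R S"
    from 1 obtain p where p: "a \<in> carrier R" "a' \<in> carrier R" "s \<in> S" "s' \<in> S" "p \<in> S"
      "p \<otimes> (a \<otimes> s') = p \<otimes> (a' \<otimes> s)" unfolding loc_rel_def by auto
    from 2 obtain q where q: "b \<in> carrier R" "b' \<in> carrier R" "t \<in> S" "t' \<in> S" "q \<in> S"
      "q \<otimes> (b \<otimes> t') = q \<otimes> (b' \<otimes> t)" unfolding loc_rel_def by auto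
    have "(p \<otimes> q) \<otimes> ((a \<otimes> b) \<otimes> (s' \<otimes> t')) = (p \<otimes> (a \<otimes> s')) \<otimes> (q \<otimes> (b \<otimes> t'))"
      using p(1-5) q(1-5) by (simp add: m_ac)
    also have "\<dots> = (p \<otimes> q) \<otimes> ((a' \<otimes> b') \<otimes> (s \<otimes> t))"
      unfolding p(6) q(6) using p(1-5) q(1-5) by (simp add: m_ac)
    finally show "loc_frac R S (a \<otimes> b) (s \<otimes> t) = loc_frac R S (a' \<otimes> b') (s' \<otimes> t')"
      by (rule loc_frac_eqI'[rotated 5]) (use p(1-5) q(1-5) in \<open>auto intro: S_mult\<close>)
  qed
  note UN_equiv_class2[OF loc_rel_equiv loc_rel_equiv this, of "(a, s)" "(b, t)"]
  then show ?thesis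
    using assms by (simp add: split_beta localization_def loc_frac_def[of R S a s] loc_frac_def[of R S b t])
qed

lemma loc_add_frac:
  assumes "a \<in> carrier R" "s \<in> S" "b \<in> carrier R" "t \<in> S"
  shows "loc_frac R S a s \<oplus>\<^bsub>localization R S\<^esub> loc_frac R S b t
    = loc_frac R S (a \<otimes> t \<oplus> b \<otimes> s) (s \<otimes> t)"
proof -
  let ?f = "\<lambda>(r, s). \<lambda>(r', s'). loc_frac R S (r \<otimes> s' \<oplus> r' \<otimes> s) (s \<otimes> s')"
  have "congruent2 (loc_rel R S) (loc_rel R S) ?f"
  proof (rule congruent2I'; clarify)
    fix a s a' s' b t b' t'
    assume 1: "((a, s), (a', s')) \<in> loc_rel R S" and 2: "((b, t), (b', t')) \<in> loc_rel R S"
    from 1 obtain p where p: "a \<in> carrier R" "a' \<in> carrier R" "s \<in> S" "s' \<in> S" "p \<in> S"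
      "p \<otimes> (a \<otimes> s') = p \<otimes> (a' \<otimes> s)" unfolding loc_rel_def by auto
    from 2 obtain q where q: "b \<in> carrier R" "b' \<in> carrier R" "t \<in> S" "t' \<in> S" "q \<in> S"
      "q \<otimes> (b \<otimes> t') = q \<otimes> (b' \<otimes> t)" unfolding loc_rel_def by auto
    have "(p \<otimes> q) \<otimes> ((a \<otimes> t \<oplus> b \<otimes> s) \<otimes> (s' \<otimes> t'))
        = (q \<otimes> t \<otimes> t') \<otimes> (p \<otimes> (a \<otimes> s')) \<oplus> (p \<otimes> s \<otimes> s') \<otimes> (q \<otimes> (b \<otimes> t'))"
      using p(1-5) q(1-5) by (simp add: m_ac r_distr l_distr)
    also have "\<dots> = (p \<otimes> q) \<otimes> ((a' \<otimes> t' \<oplus> b' \<otimes> s') \<otimes> (s \<otimes> t))"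
      unfolding p(6) q(6) using p(1-5) q(1-5) by (simp add: m_ac r_distr l_distr)
    finally show "loc_frac R S (a \<otimes> t \<oplus> b \<otimes> s) (s \<otimes> t)
        = loc_frac R S (a' \<otimes> t' \<oplus> b' \<otimes> s') (s' \<otimes> t')"
      by (rule loc_frac_eqI'[rotated 5]) (use p(1-5) q(1-5) in \<open>auto intro: S_mult\<close>)
  qed
  note UN_equiv_class2[OF loc_rel_equiv loc_rel_equiv this, of "(a, s)" "(b, t)"]
  then show ?thesis
    using assms by (simp add: split_beta localization_def loc_frac_def[of R S a s] loc_frac_def[of R S b t])
qed

lemma loc_zero: "\<zero>\<^bsub>localization R S\<^esub> = loc_frac R S \<zero> \<one>"
  and loc_one: "\<one>\<^bsub>localization R S\<^esub> = loc_frac R S \<one> \<one>"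
  by (simp_all add: localization_def)

lemma localization_cring: "cring (localization R S)"
proof (rule cringI)
  let ?L = "localization R S"
  note simps = loc_mult_frac loc_add_frac loc_zero loc_one S_one S_mult
  show "abelian_group ?L"
  proof (rule abelian_groupI)
    show "\<zero>\<^bsub>?L\<^esub> \<in> carrier ?L"
      by (simp add: loc_zero S_one)
  next
    fix U V assume "U \<in> carrier ?L" "V \<in> carrier ?L"
    then obtain a s b t where *: "a \<in> carrier R" "s \<in> S" "b \<in> carrier R" "t \<in> S"
        and UV: "U = loc_frac R S a s" "V = loc_frac R S b t"
      by (elim loc_cases) blast
    show "U \<oplus>\<^bsub>?L\<^esub> V \<in> carrier ?L"
      unfolding UV using * by (simp add: simps)
    have "a \<otimes> t \<oplus> b \<otimes> s = b \<otimes> s \<oplus> a \<otimes> t" "s \<otimes> t = t \<otimes> s"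
      using * by (simp_all add: a_comm m_comm)
    then show "U \<oplus>\<^bsub>?L\<^esub> V = V \<oplus>\<^bsub>?L\<^esub> U"
      unfolding UV using * by (simp add: simps)
  next
    fix U V W assume "U \<in> carrier ?L" "V \<in> carrier ?L" "W \<in> carrier ?L"
    then obtain a s b t c u where *: "a \<in> carrier R" "s \<in> S" "b \<in> carrier R" "t \<in> S"
        "c \<in> carrier R" "u \<in> S"
        and UVW: "U = loc_frac R S a s" "V = loc_frac R S b t" "W = loc_frac R S c u"
      by (elim loc_cases) blast
    have "(a \<otimes> t \<oplus> b \<otimes> s) \<otimes> u \<oplus> c \<otimes> (s \<otimes> t) = a \<otimes> (t \<otimes> u) \<oplus> (b \<otimes> u \<oplus> c \<otimes> t) \<otimes> s"
      using * by (simp add: l_distr r_distr m_ac a_ac)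
    moreover have "s \<otimes> t \<otimes> u = s \<otimes> (t \<otimes> u)"
      using * by (simp add: m_assoc)
    ultimately show "(U \<oplus>\<^bsub>?L\<^esub> V) \<oplus>\<^bsub>?L\<^esub> W = U \<oplus>\<^bsub>?L\<^esub> (V \<oplus>\<^bsub>?L\<^esub> W)"
      unfolding UVW using * by (simp add: simps)
  next
    fix U assume "U \<in> carrier ?L"
    then obtain a s where U: "a \<in> carrier R" "s \<in> S" "U = loc_frac R S a s"
      by (rule loc_cases)
    then show "\<zero>\<^bsub>?L\<^esub> \<oplus>\<^bsub>?L\<^esub> U = U"
      by (simp add: simps)
    have "loc_frac R S (\<ominus> a) s \<oplus>\<^bsub>?L\<^esub> U = loc_frac R S \<zero> (s \<otimes> s)"
      using U by (simp add: simps l_minus l_neg)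
    also have "\<dots> = \<zero>\<^bsub>?L\<^esub>"
      unfolding loc_zero by (rule loc_frac_eqI) (use U in \<open>simp_all add: S_one S_mult\<close>)
    finally show "\<exists>V\<in>carrier ?L. V \<oplus>\<^bsub>?L\<^esub> U = \<zero>\<^bsub>?L\<^esub>"
      using U by (intro bexI[of _ "loc_frac R S (\<ominus> a) s"]) simp_all
  qed
  show "comm_monoid ?L"
  proof (rule comm_monoidI)
    show "\<one>\<^bsub>?L\<^esub> \<in> carrier ?L"
      by (simp add: loc_one S_one)
  next
    fix U assume "U \<in> carrier ?L"
    then obtain a s where "a \<in> carrier R" "s \<in> S" "U = loc_frac R S a s"
      by (rule loc_cases)
    then show "\<one>\<^bsub>?L\<^esub> \<otimes>\<^bsub>?L\<^esub> U = U"
      by (simp add: simps)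
  next
    fix U V assume "U \<in> carrier ?L" "V \<in> carrier ?L"
    then obtain a s b t where *: "a \<in> carrier R" "s \<in> S" "b \<in> carrier R" "t \<in> S"
        and UV: "U = loc_frac R S a s" "V = loc_frac R S b t"
      by (elim loc_cases) blast
    show "U \<otimes>\<^bsub>?L\<^esub> V \<in> carrier ?L"
      unfolding UV using * by (simp add: simps)
    have "a \<otimes> b = b \<otimes> a" "s \<otimes> t = t \<otimes> s"
      using * by (simp_all add: m_comm)
    then show "U \<otimes>\<^bsub>?L\<^esub> V = V \<otimes>\<^bsub>?L\<^esub> U"
      unfolding UV using * by (simp add: simps)
  next
    fix U V W assume "U \<in> carrier ?L" "V \<in> carrier ?L" "W \<in> carrier ?L"
    then obtain a s b t c u where *: "a \<in> carrier R" "s \<in> S" "b \<in> carrier R" "t \<in> S"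
        "c \<in> carrier R" "u \<in> S"
        and UVW: "U = loc_frac R S a s" "V = loc_frac R S b t" "W = loc_frac R S c u"
      by (elim loc_cases) blast
    show "(U \<otimes>\<^bsub>?L\<^esub> V) \<otimes>\<^bsub>?L\<^esub> W = U \<otimes>\<^bsub>?L\<^esub> (V \<otimes>\<^bsub>?L\<^esub> W)"
      unfolding UVW using * by (simp add: simps m_assoc)
  qed
  fix U V W assume "U \<in> carrier ?L" "V \<in> carrier ?L" "W \<in> carrier ?L"
  then obtain a s b t c u where *: "a \<in> carrier R" "s \<in> S" "b \<in> carrier R" "t \<in> S"
      "c \<in> carrier R" "u \<in> S"
      and UVW: "U = loc_frac R S a s" "V = loc_frac R S b t" "W = loc_frac R S c u"
    by (elim loc_cases) blast
  have "loc_frac R S ((a \<otimes> t \<oplus> b \<otimes> s) \<otimes> c) (s \<otimes> t \<otimes> u)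
      = loc_frac R S (a \<otimes> c \<otimes> (t \<otimes> u) \<oplus> b \<otimes> c \<otimes> (s \<otimes> u)) (s \<otimes> u \<otimes> (t \<otimes> u))"
    by (rule loc_frac_eqI) (use * in \<open>simp_all add: S_mult l_distr r_distr m_ac\<close>)
  then show "(U \<oplus>\<^bsub>?L\<^esub> V) \<otimes>\<^bsub>?L\<^esub> W = U \<otimes>\<^bsub>?L\<^esub> W \<oplus>\<^bsub>?L\<^esub> V \<otimes>\<^bsub>?L\<^esub> W"
    unfolding UVW using * by (simp add: simps)
qed

end

context cring
begin

lemma nonzerodivisorD:
  "\<lbrakk>s \<in> nonzerodivisors R; r \<in> carrier R; s \<otimes> r = \<zero>\<rbrakk> \<Longrightarrow> r = \<zero>"
  unfolding nonzerodivisors_def by blast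

lemma nonzerodivisors_mult_subset: "mult_subset R (nonzerodivisors R)"
proof unfold_locales
  show "nonzerodivisors R \<subseteq> carrier R" "\<one> \<in> nonzerodivisors R"
    by (auto simp: nonzerodivisors_def)
  fix s t assume st: "s \<in> nonzerodivisors R" "t \<in> nonzerodivisors R"
  then have carr: "s \<in> carrier R" "t \<in> carrier R"
    by (auto simp: nonzerodivisors_def)
  have "r = \<zero>" if "r \<in> carrier R" "s \<otimes> t \<otimes> r = \<zero>" for r
  proof -
    have "s \<otimes> (t \<otimes> r) = \<zero>" "t \<otimes> r \<in> carrier R"
      using that carr by (simp_all add: m_assoc)
    then have "t \<otimes> r = \<zero>"
      using nonzerodivisorD[OF st(1)] by blast
    then show ?thesis
      using nonzerodivisorD[OF st(2)] that(1) by blast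
  qed
  then show "s \<otimes> t \<in> nonzerodivisors R"
    using carr by (simp add: nonzerodivisors_def)
qed

lemma total_fractions_cring: "cring (total_fractions R)"
  unfolding total_fractions_def
  by (rule mult_subset.localization_cring[OF nonzerodivisors_mult_subset])

lemma to_fractions_hom: "to_fractions R \<in> ring_hom R (total_fractions R)"
proof -
  interpret mult_subset R "nonzerodivisors R" by (rule nonzerodivisors_mult_subset)
  show ?thesis
    by (rule ring_hom_memI)
      (simp_all add: to_fractions_def total_fractions_def loc_mult_frac loc_add_frac loc_one S_one)
qed

lemma to_fractions_inj: "inj_on (to_fractions R) (carrier R)"
proof -
  interpret mult_subset R "nonzerodivisors R" by (rule nonzerodivisors_mult_subset)
  show ?thesis
  proof (rule inj_onI)
    fix a b assume ab: "a \<in> carrier R" "b \<in> carrier R" "to_fractions R a = to_fractions R b"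
    then obtain u where u: "u \<in> nonzerodivisors R" "u \<otimes> a = u \<otimes> b"
      by (auto simp: to_fractions_def loc_frac_eq_iff S_one)
    then have "u \<otimes> (a \<ominus> b) = \<zero>"
      using ab(1,2) by (simp add: minus_eq r_distr r_minus r_neg)
    moreover have "a \<ominus> b \<in> carrier R"
      using ab(1,2) by simp
    ultimately have "a \<ominus> b = \<zero>"
      using nonzerodivisorD[OF u(1)] ab(1,2) by blast
    then show "a = b"
      using ab(1,2) by simp
  qed
qed

end

end

theory Submission
  imports Defs
begin

text \<open>
  A Noetherian local ring \<open>R\<close> of dimension one is Cohen-Macaulay if and only if \<open>\<mm>\<close> contains a
  nonzerodivisor: if \<open>x \<in> \<mm>\<close> is one, then \<open>R/(x)\<close> has a nonzero element killed by \<open>\<mm>\<close>, because the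
  only prime ideal containing \<open>x\<close> is \<open>\<mm>\<close>; hence no regular sequence in \<open>\<mm>\<close> has length two.

  If \<open>\<mm>\<close> consists of zero divisors, then all nonzerodivisors are units, so \<open>R\<close> is its own total ring
  of fractions and the conductor is \<open>R\<close>.  Moreover \<open>R\<close> has a nonzero nilpotent element, since a
  reduced Noetherian local ring of depth zero is a field.  As the integral closure of the zero ideal
  contains the elements of square zero, \<open>1 \<notin> \<tau>\<close>.

  The inclusion of \<open>\<tau>\<close> in the conductor holds in every commutative ring: a fraction \<open>y/c\<close> is integral
  over \<open>R\<close> exactly when \<open>y\<close> is integral over the ideal \<open>(c)\<close>, and then \<open>r \<in> \<tau>\<close> gives \<open>r y \<in> (c)\<close>,
  that is, \<open>r y/c \<in> R\<close>.

  For the opposite inclusion let \<open>r\<close> be in the conductor and \<open>y\<close> integral over \<open>I\<close>.  If \<open>I\<close> contains a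
  nonzerodivisor, it has a principal reduction (lemma \<open>principal_reduction\<close>): there are a
  nonzerodivisor \<open>c \<in> I\<close> and an ideal \<open>M\<close> containing a nonzerodivisor with \<open>I M \<subseteq> c M\<close>.  Then \<open>y/c\<close> is
  integral over \<open>R\<close>, so \<open>r y \<in> c R \<subseteq> I\<close>.  In general apply this to the ideals \<open>I + (d\<^sup>n)\<close> for a
  nonzerodivisor \<open>d \<in> \<mm>\<close> and intersect over \<open>n\<close>, using Krull's intersection theorem in \<open>R/I\<close>.

  Principal reductions are obtained by replacing two elements \<open>a, b\<close> by one combination \<open>a - t b\<close> at a
  time.  Dimension one enters through lengths: for a nonzerodivisor \<open>a\<close> and the ideal
  \<open>M = (a, b)\<^sup>n\<close> the length of \<open>M/aM\<close> is at most that of \<open>R/aR\<close>, so for large \<open>n\<close> the monomials of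
  degree \<open>n\<close> in \<open>a\<close> and \<open>b\<close> satisfy a relation that is monic modulo \<open>\<mm>\<close>.  Since the residue field is
  infinite, some \<open>t\<close> is not a root of it, and \<open>a - t b\<close> for this \<open>t\<close> generates a reduction.

  The ascending chain condition takes the place of the determinant trick: if a fraction multiplies
  an ideal containing a nonzerodivisor into itself, then its powers become linearly dependent.
\<close>

section \<open>Ideals in commutative rings\<close>

context cring
begin

lemma ideal_criterion:
  assumes "I \<subseteq> carrier R" "\<zero> \<in> I"
    and "\<And>x y. \<lbrakk>x \<in> I; y \<in> I\<rbrakk> \<Longrightarrow> x \<oplus> y \<in> I"
    and "\<And>r x. \<lbrakk>r \<in> carrier R; x \<in> I\<rbrakk> \<Longrightarrow> r \<otimes> x \<in> I"
  shows "ideal I R"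
proof (rule idealI[OF ring_axioms])
  show "subgroup I (add_monoid R)"
  proof (rule add.subgroupI)
    show "I \<noteq> {}" "I \<subseteq> carrier R"
      using assms by auto
    show "\<ominus> x \<in> I" if "x \<in> I" for x
    proof -
      have "(\<ominus> \<one>) \<otimes> x \<in> I" "x \<in> carrier R"
        using assms(1) assms(4)[of "\<ominus> \<one>"] that by auto
      then show ?thesis
        by (simp add: l_minus)
    qed
  qed (use assms in auto)
  show "r \<otimes> x \<in> I" if "x \<in> I" "r \<in> carrier R" for x r
    using assms(4) that by blast
  then show "x \<otimes> r \<in> I" if "x \<in> I" "r \<in> carrier R" for x r
    using that assms(1) by (simp add: m_comm[of x r] subset_iff)
qed

lemma ideal_subset: "ideal I R \<Longrightarrow> I \<subseteq> carrier R"
  by (simp add: additive_subgroup.a_subset ideal.axioms(1))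

lemma ideal_zero: "ideal I R \<Longrightarrow> \<zero> \<in> I"
  by (simp add: additive_subgroup.zero_closed ideal.axioms(1))

lemma ideal_add: "\<lbrakk>ideal I R; x \<in> I; y \<in> I\<rbrakk> \<Longrightarrow> x \<oplus> y \<in> I"
  by (simp add: additive_subgroup.a_closed ideal.axioms(1))

lemma ideal_a_inv: "\<lbrakk>ideal I R; x \<in> I\<rbrakk> \<Longrightarrow> \<ominus> x \<in> I"
  by (simp add: additive_subgroup.a_inv_closed ideal.axioms(1))

lemma ideal_minus: "\<lbrakk>ideal I R; x \<in> I; y \<in> I\<rbrakk> \<Longrightarrow> x \<ominus> y \<in> I"
  by (simp add: a_minus_def ideal_add ideal_a_inv)

lemma minus_minus_cancel:
  assumes "x \<in> carrier R" "y \<in> carrier R" "t \<in> carrier R"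
  shows "(x \<ominus> t) \<ominus> (y \<ominus> t) = x \<ominus> y"
proof -
  have "(x \<ominus> t) \<ominus> (y \<ominus> t) = (x \<ominus> y) \<oplus> (t \<ominus> t)"
    using assms by (simp add: a_minus_def minus_add a_ac)
  then show ?thesis
    using assms by (simp add: a_minus_def r_neg)
qed

lemma add_minus_cancel_left:
  assumes "x \<in> carrier R" "y \<in> carrier R"
  shows "(x \<oplus> y) \<ominus> x = y"
proof -
  have "(x \<oplus> y) \<ominus> x = (x \<ominus> x) \<oplus> y"
    using assms by (simp add: a_minus_def a_ac)
  then show ?thesis
    using assms by (simp add: a_minus_def r_neg)
qed

lemma ideal_finsum:
  assumes "ideal I R" "finite A" "\<And>i. i \<in> A \<Longrightarrow> f i \<in> I"
  shows "(\<Oplus>i\<in>A. f i) \<in> I"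
  using assms(2,3)
proof (induction A rule: finite_induct)
  case empty
  then show ?case by (simp add: ideal_zero[OF assms(1)])
next
  case (insert x F)
  have "f \<in> insert x F \<rightarrow> carrier R"
    using insert.prems ideal.Icarr[OF assms(1)] by blast
  then show ?case
    using insert by (simp add: ideal_add[OF assms(1)])
qed

lemma mem_ideal_sum: "x \<in> I <+> J \<longleftrightarrow> (\<exists>i\<in>I. \<exists>j\<in>J. x = i \<oplus> j)"
  by (auto simp: set_add_def')

lemma ideal_sum_upper:
  assumes "ideal I R" "ideal J R"
  shows "I \<subseteq> I <+> J" "J \<subseteq> I <+> J"
proof -
  show "I \<subseteq> I <+> J"
    using ideal_zero[OF assms(2)] ideal.Icarr[OF assms(1)]
    by (force simp: mem_ideal_sum)
  show "J \<subseteq> I <+> J"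
    using ideal_zero[OF assms(1)] ideal.Icarr[OF assms(2)]
    by (force simp: mem_ideal_sum)
qed

lemma ideal_sum_least: "\<lbrakk>ideal K R; I \<subseteq> K; J \<subseteq> K\<rbrakk> \<Longrightarrow> I <+> J \<subseteq> K"
  unfolding mem_ideal_sum subset_iff using ideal_add[of K] by metis

lemma ideal_sum_mono: "\<lbrakk>I \<subseteq> I'; J \<subseteq> J'\<rbrakk> \<Longrightarrow> I <+>\<^bsub>R\<^esub> J \<subseteq> I' <+>\<^bsub>R\<^esub> J'"
  by (fastforce simp: mem_ideal_sum)

lemma ideal_colon_ideal:
  assumes "ideal I R" "J \<subseteq> carrier R"
  shows "ideal (ideal_colon R I J) R"
proof (rule ideal_criterion)
  show "\<zero> \<in> ideal_colon R I J"
    using assms ideal_zero by (auto simp: ideal_colon_def)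
  show "x \<oplus> y \<in> ideal_colon R I J" if "x \<in> ideal_colon R I J" "y \<in> ideal_colon R I J" for x y
    using that assms ideal_add[OF assms(1)] by (auto simp: ideal_colon_def l_distr subset_iff)
  show "r \<otimes> x \<in> ideal_colon R I J" if "r \<in> carrier R" "x \<in> ideal_colon R I J" for r x
    using that assms ideal.I_l_closed[OF assms(1)]
    by (auto simp: ideal_colon_def m_assoc subset_iff)
qed (auto simp: ideal_colon_def)

text \<open>
  Containment of \<open>a \<cdot> Idl S\<close> in an ideal can be tested on \<open>S\<close>, because the elements that \<open>a\<close> multiplies
  into \<open>I\<close> form an ideal.
\<close>
lemma Idl_mult_closed:
  assumes "ideal I R" "S \<subseteq> carrier R" "a \<in> carrier R"
    and "\<And>s. s \<in> S \<Longrightarrow> a \<otimes> s \<in> I" "u \<in> Idl S"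
  shows "a \<otimes> u \<in> I"
proof -
  have "S \<subseteq> ideal_colon R I {a}"
    using assms(2-4) by (auto simp: ideal_colon_def m_comm[of _ a])
  then have "u \<in> ideal_colon R I {a}"
    using genideal_minimal[OF ideal_colon_ideal[OF assms(1)]] assms(3,5) by blast
  then show ?thesis
    using assms(3) by (auto simp: ideal_colon_def m_comm[of _ a])
qed

lemma scaled_ideal:
  assumes "ideal I R" "a \<in> carrier R"
  shows "ideal ((\<otimes>) a ` I) R"
proof (rule ideal_criterion)
  show "\<zero> \<in> (\<otimes>) a ` I"
    using ideal_zero[OF assms(1)] assms(2) by (auto intro!: image_eqI[of _ _ "\<zero>"])
  show "x \<oplus> y \<in> (\<otimes>) a ` I" if "x \<in> (\<otimes>) a ` I" "y \<in> (\<otimes>) a ` I" for x y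
    using that assms ideal_add[OF assms(1)] ideal.Icarr[OF assms(1)]
    by (auto simp flip: r_distr)
  show "r \<otimes> x \<in> (\<otimes>) a ` I" if r: "r \<in> carrier R" and x: "x \<in> (\<otimes>) a ` I" for r x
  proof -
    obtain i where "i \<in> I" "x = a \<otimes> i"
      using x by blast
    then have "r \<otimes> x = a \<otimes> (r \<otimes> i)" "r \<otimes> i \<in> I"
      using r assms(2) ideal.Icarr[OF assms(1)] ideal.I_l_closed[OF assms(1)]
      by (auto simp: m_lcomm)
    then show ?thesis by blast
  qed
qed (use assms(2) ideal.Icarr[OF assms(1)] in auto)

lemma scaled_ideal_subset:
  assumes "ideal I R" "a \<in> carrier R"
  shows "(\<otimes>) a ` I \<subseteq> I"
  using assms ideal.I_l_closed by fast

text \<open>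
  The generated ideal is an intersection of ideals; relations between elements need the actual
  coefficients.
\<close>
lemma Idl_image_combination:
  assumes "\<And>i. i < n \<Longrightarrow> w i \<in> carrier R" "x \<in> Idl (w ` {..<n})"
  obtains r where "\<And>i. r i \<in> carrier R" "x = (\<Oplus>i\<in>{..<n::nat}. r i \<otimes> w i)"
proof -
  define C where "C = {(\<Oplus>i\<in>{..<n}. r i \<otimes> w i) | r. \<forall>i. r i \<in> carrier R}"
  have "ideal C R"
  proof (rule ideal_criterion)
    show "C \<subseteq> carrier R"
      using assms(1) by (auto simp: C_def intro!: finsum_closed)
    show "\<zero> \<in> C"
    proof -
      have "(\<Oplus>i\<in>{..<n}. \<zero> \<otimes> w i) = (\<Oplus>i\<in>{..<n}. \<zero>)"
        using assms(1) by (intro finsum_cong') auto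
      then show ?thesis
        unfolding C_def by (auto intro!: exI[of _ "\<lambda>_. \<zero>"])
    qed
    fix x y assume "x \<in> C" "y \<in> C"
    then obtain r s where r: "\<forall>i. r i \<in> carrier R" "x = (\<Oplus>i\<in>{..<n}. r i \<otimes> w i)"
      and s: "\<forall>i. s i \<in> carrier R" "y = (\<Oplus>i\<in>{..<n}. s i \<otimes> w i)"
      unfolding C_def by blast
    have "(\<Oplus>i\<in>{..<n}. (r i \<oplus> s i) \<otimes> w i) = (\<Oplus>i\<in>{..<n}. r i \<otimes> w i \<oplus> s i \<otimes> w i)"
      using r s assms(1) by (intro finsum_cong') (auto simp: l_distr)
    also have "\<dots> = x \<oplus> y"
      unfolding r s using r s assms(1) by (intro finsum_addf) auto
    finally show "x \<oplus> y \<in> C"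
      unfolding C_def using r s by (auto intro!: exI[of _ "\<lambda>i. r i \<oplus> s i"])
  next
    fix t x assume t: "t \<in> carrier R" and "x \<in> C"
    then obtain r where r: "\<forall>i. r i \<in> carrier R" "x = (\<Oplus>i\<in>{..<n}. r i \<otimes> w i)"
      unfolding C_def by blast
    have "t \<otimes> x = (\<Oplus>i\<in>{..<n}. t \<otimes> (r i \<otimes> w i))"
      unfolding r using r t assms(1) by (intro finsum_rdistr) auto
    also have "\<dots> = (\<Oplus>i\<in>{..<n}. (t \<otimes> r i) \<otimes> w i)"
      using r t assms(1) by (intro finsum_cong') (auto simp: m_assoc)
    finally show "t \<otimes> x \<in> C"
      unfolding C_def using r t by (auto intro!: exI[of _ "\<lambda>i. t \<otimes> r i"])
  qed
  moreover have "w ` {..<n} \<subseteq> C"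
  proof clarify
    fix j assume j: "j < n"
    have "(\<Oplus>i\<in>{..<n}. (if j = i then \<one> else \<zero>) \<otimes> w i)
        = (\<Oplus>i\<in>{..<n}. if j = i then w i else \<zero>)"
      using assms(1) by (intro finsum_cong') auto
    also have "\<dots> = w j"
      using assms(1) j by (intro finsum_singleton) auto
    finally show "w j \<in> C"
      unfolding C_def by (auto intro!: exI[of _ "\<lambda>i. if j = i then \<one> else \<zero>"])
  qed
  ultimately have "x \<in> C"
    using genideal_minimal assms(2) by blast
  then show thesis
    using that unfolding C_def by blast
qed

lemma nonzerodivisor_carrier: "s \<in> nonzerodivisors R \<Longrightarrow> s \<in> carrier R"
  by (simp add: nonzerodivisors_def)

lemma nonzerodivisor_mult:
  "\<lbrakk>s \<in> nonzerodivisors R; t \<in> nonzerodivisors R\<rbrakk> \<Longrightarrow> s \<otimes> t \<in> nonzerodivisors R"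
  by (rule mult_subset.S_mult[OF nonzerodivisors_mult_subset])

lemma nonzerodivisor_one: "\<one> \<in> nonzerodivisors R"
  by (rule mult_subset.S_one[OF nonzerodivisors_mult_subset])

lemma nonzerodivisor_pow: "s \<in> nonzerodivisors R \<Longrightarrow> s [^] (n::nat) \<in> nonzerodivisors R"
  by (induction n) (simp_all add: nonzerodivisor_one nonzerodivisor_mult)

lemma nonzerodivisor_cancel:
  assumes "s \<in> nonzerodivisors R" "x \<in> carrier R" "y \<in> carrier R" "s \<otimes> x = s \<otimes> y"
  shows "x = y"
proof -
  have "s \<otimes> (x \<ominus> y) = \<zero>"
    using assms nonzerodivisor_carrier[OF assms(1)]
    by (simp add: minus_eq r_distr r_minus r_neg)
  then have "x \<ominus> y = \<zero>"
    using nonzerodivisorD[OF assms(1)] assms by simp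
  then show ?thesis
    using assms by simp
qed

lemma nonzerodivisor_factor:
  assumes "a \<otimes> b \<in> nonzerodivisors R" "a \<in> carrier R" "b \<in> carrier R"
  shows "a \<in> nonzerodivisors R"
proof -
  have "r = \<zero>" if "r \<in> carrier R" "a \<otimes> r = \<zero>" for r
  proof -
    have "(a \<otimes> b) \<otimes> r = b \<otimes> (a \<otimes> r)"
      using that(1) assms by (simp add: m_ac)
    then have "(a \<otimes> b) \<otimes> r = \<zero>"
      unfolding that(2) using assms by simp
    then show ?thesis
      using nonzerodivisorD[OF assms(1)] that by blast
  qed
  then show ?thesis
    using assms(2) by (simp add: nonzerodivisors_def)
qed

end

section \<open>Noetherian rings\<close>

lemma (in noetherian_ring) maximal_ideal_of_family:
  assumes "S \<noteq> {}" "\<And>I. I \<in> S \<Longrightarrow> ideal I R"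
  obtains M where "M \<in> S" "\<And>J. \<lbrakk>J \<in> S; M \<subseteq> J\<rbrakk> \<Longrightarrow> J = M"
proof -
  have "\<exists>M\<in>S. \<forall>J\<in>S. M \<subseteq> J \<longrightarrow> J = M"
  proof (rule subset_Zorn)
    fix C assume C: "subset.chain S C"
    show "\<exists>U\<in>S. \<forall>J\<in>C. J \<subseteq> U"
    proof (cases "C = {}")
      case True
      then show ?thesis using assms(1) by blast
    next
      case False
      have "subset.chain {I. ideal I R} C"
        using C assms(2) unfolding pred_on.chain_def by blast
      then have "\<Union>C \<in> C"
        by (rule ideal_chain_is_trivial[OF False])
      moreover have "C \<subseteq> S"
        using C by (simp add: pred_on.chain_def)
      ultimately show ?thesis
        by (meson Union_upper subsetD)
    qed
  qed
  then show thesis using that by metis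
qed

locale noetherian_cring = cring + noetherian_ring
begin

text \<open>
  The ascending chain condition in the form used to produce equations of integral dependence.
\<close>
lemma sequence_eventually_dependent:
  fixes w :: "nat \<Rightarrow> 'a"
  assumes w: "\<And>i. w i \<in> carrier R"
  obtains r n where "\<And>i. r i \<in> carrier R" "w n = (\<Oplus>i\<in>{..<n}. r i \<otimes> w i)"
proof -
  let ?I = "\<lambda>n. Idl (w ` {..<n})"
  have sub: "w ` A \<subseteq> carrier R" for A
    using w by blast
  obtain M where M: "M \<in> range ?I" "\<And>J. \<lbrakk>J \<in> range ?I; M \<subseteq> J\<rbrakk> \<Longrightarrow> J = M"
    by (rule maximal_ideal_of_family[of "range ?I"]) (auto intro: genideal_ideal[OF sub])
  then obtain n where n: "M = ?I n"
    by blast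
  have "w n \<in> ?I (Suc n)"
    using genideal_self[OF sub] by blast
  moreover have "?I n \<subseteq> ?I (Suc n)"
    by (rule subset_Idl_subset[OF sub]) auto
  ultimately have "w n \<in> ?I n"
    using M(2)[of "?I (Suc n)"] n by blast
  then show thesis
    using Idl_image_combination[of n w] w that by metis
qed

text \<open>
  An ideal that is maximal among the ideals avoiding a multiplicative set is prime.
\<close>
lemma prime_avoiding_mult_set:
  assumes "T \<subseteq> carrier R" "\<And>s t. \<lbrakk>s \<in> T; t \<in> T\<rbrakk> \<Longrightarrow> s \<otimes> t \<in> T" "\<one> \<in> T"
    and "ideal I R" "I \<inter> T = {}"
  obtains P where "primeideal P R" "I \<subseteq> P" "P \<inter> T = {}"
proof -
  let ?S = "{J. ideal J R \<and> I \<subseteq> J \<and> J \<inter> T = {}}"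
  obtain P where P: "P \<in> ?S" "\<And>J. \<lbrakk>J \<in> ?S; P \<subseteq> J\<rbrakk> \<Longrightarrow> J = P"
    by (rule maximal_ideal_of_family[of ?S]) (use assms in auto)
  have PR: "ideal P R" and disj: "P \<inter> T = {}"
    using P by auto
  have meets: "\<exists>r\<in>carrier R. \<exists>p\<in>P. p \<oplus> r \<otimes> a \<in> T" if a: "a \<in> carrier R" "a \<notin> P" for a
  proof -
    let ?J = "P <+>\<^bsub>R\<^esub> PIdl a"
    have J: "ideal ?J R"
      using add_ideals PR cgenideal_ideal a(1) by blast
    have "P \<subseteq> ?J" "a \<in> ?J"
      using ideal_sum_upper[OF PR cgenideal_ideal[OF a(1)]] cgenideal_self[OF a(1)] by auto
    then have "?J \<notin> ?S"
      using P(2) a(2) by blast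
    then obtain t where "t \<in> ?J" "t \<in> T"
      using J \<open>P \<subseteq> ?J\<close> P(1) by blast
    then show ?thesis
      by (auto simp: mem_ideal_sum cgenideal_def)
  qed
  have "primeideal P R"
  proof (rule primeidealI[OF PR])
    show "cring R" by (rule is_cring)
    show "carrier R \<noteq> P"
      using disj assms(3) by auto
    fix a b assume ab: "a \<in> carrier R" "b \<in> carrier R" "a \<otimes> b \<in> P"
    show "a \<in> P \<or> b \<in> P"
    proof (rule ccontr)
      assume "\<not> (a \<in> P \<or> b \<in> P)"
      then obtain r p s q where *: "r \<in> carrier R" "p \<in> P" "p \<oplus> r \<otimes> a \<in> T"
        "s \<in> carrier R" "q \<in> P" "q \<oplus> s \<otimes> b \<in> T"
        using meets ab by meson
      have carr: "p \<in> carrier R" "q \<in> carrier R"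
        using * ideal.Icarr[OF PR] by auto
      have "(p \<oplus> r \<otimes> a) \<otimes> (q \<oplus> s \<otimes> b)
          = p \<otimes> (q \<oplus> s \<otimes> b) \<oplus> ((r \<otimes> a) \<otimes> q \<oplus> (r \<otimes> s) \<otimes> (a \<otimes> b))"
        using * carr ab by (simp add: l_distr r_distr m_ac a_ac)
      also have "\<dots> \<in> P"
      proof (intro ideal_add[OF PR])
        show "p \<otimes> (q \<oplus> s \<otimes> b) \<in> P"
          using * carr ab by (intro ideal.I_r_closed[OF PR]) auto
      qed (use * carr ab in \<open>auto intro!: ideal.I_l_closed[OF PR]\<close>)
      finally show False
        using assms(2)[OF *(3,6)] disj by blast
    qed
  qed
  then show thesis
    using that P(1) by blast
qed

text \<open>
  Every nonzero cyclic module has an associated prime: an annihilator of a nonzero element of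
  \<open>R/D\<close> that is maximal among such annihilators is prime.
\<close>
lemma associated_prime_exists:
  assumes D: "ideal D R" "D \<noteq> carrier R"
  obtains z where "z \<in> carrier R" "z \<notin> D" "primeideal (ideal_colon R D {z}) R"
proof -
  let ?A = "\<lambda>z. ideal_colon R D {z}"
  have A: "ideal (?A z) R" if "z \<in> carrier R" for z
    using that by (intro ideal_colon_ideal[OF D(1)]) auto
  obtain M where M: "M \<in> ?A ` (carrier R - D)"
    "\<And>J. \<lbrakk>J \<in> ?A ` (carrier R - D); M \<subseteq> J\<rbrakk> \<Longrightarrow> J = M"
    by (rule maximal_ideal_of_family[of "?A ` (carrier R - D)"])
      (use A D ideal_subset[OF D(1)] in auto)
  then obtain z where z: "z \<in> carrier R" "z \<notin> D" "M = ?A z"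
    by blast
  have "primeideal (?A z) R"
  proof (rule primeidealI[OF A is_cring])
    show "carrier R \<noteq> ?A z"
    proof
      assume "carrier R = ?A z"
      then have "\<one> \<in> ?A z" by auto
      then show False
        using z by (auto simp: ideal_colon_def)
    qed
    fix a b assume ab: "a \<in> carrier R" "b \<in> carrier R" "a \<otimes> b \<in> ?A z"
    show "a \<in> ?A z \<or> b \<in> ?A z"
    proof (rule ccontr)
      assume *: "\<not> (a \<in> ?A z \<or> b \<in> ?A z)"
      then have bz: "b \<otimes> z \<in> carrier R - D"
        using ab z by (auto simp: ideal_colon_def)
      have "?A z \<subseteq> ?A (b \<otimes> z)"
        using ab z ideal.I_l_closed[OF D(1)] by (auto simp: ideal_colon_def m_lcomm[of _ b z])
      then have "?A (b \<otimes> z) = ?A z"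
        using M(2) bz z(3) by blast
      moreover have "a \<in> ?A (b \<otimes> z)"
        using ab z by (auto simp: ideal_colon_def m_assoc)
      ultimately show False
        using * by blast
    qed
  qed (use z in auto)
  then show thesis
    using that z by blast
qed

text \<open>
  The case of Krull's intersection theorem for a principal ideal.  If \<open>w\<close> is congruent to
  \<open>x\<^sup>n r\<^sub>n\<close> modulo \<open>I\<close> for all \<open>n\<close>, then a relation expressing \<open>r\<^sub>n\<close> through the earlier \<open>r\<^sub>i\<close>,
  multiplied by \<open>x\<^sup>n\<close>, becomes \<open>w = x b w\<close> modulo \<open>I\<close>.
\<close>
lemma principal_krull_intersection:
  assumes I: "ideal I R" and x: "x \<in> carrier R" and w: "w \<in> carrier R"
    and inter: "\<And>n::nat. w \<in> I <+>\<^bsub>R\<^esub> PIdl (x [^] n)"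
  obtains b where "b \<in> carrier R" "w \<ominus> (x \<otimes> b) \<otimes> w \<in> I"
proof -
  note [simp] = ideal.Icarr[OF I]
  have "\<exists>r\<in>carrier R. w \<ominus> r \<otimes> x [^] n \<in> I" for n :: nat
  proof -
    obtain i r where "i \<in> I" "r \<in> carrier R" "w = i \<oplus> r \<otimes> x [^] n"
      using inter[of n] by (auto simp: mem_ideal_sum cgenideal_def)
    then show ?thesis
      using x by (intro bexI[of _ r]) (simp_all add: a_minus_def a_assoc r_neg)
  qed
  then obtain r where r: "\<And>n. r n \<in> carrier R" "\<And>n::nat. w \<ominus> r n \<otimes> x [^] n \<in> I"
    by metis
  obtain b n where b: "\<And>i. b i \<in> carrier R" "r n = (\<Oplus>i\<in>{..<n}. b i \<otimes> r i)"
    by (rule sequence_eventually_dependent[of r, OF r(1)]) (rule that)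
  define c where "c = (\<Oplus>i\<in>{..<n}. b i \<otimes> x [^] (n - Suc i))"
  have c: "c \<in> carrier R"
    unfolding c_def using b x by (intro finsum_closed) auto
  have eq1: "r n \<otimes> x [^] n = (\<Oplus>i\<in>{..<n}. (b i \<otimes> r i) \<otimes> x [^] n)"
    unfolding b(2) using b r x by (intro finsum_ldistr) auto
  have eq2: "(x \<otimes> c) \<otimes> w = (\<Oplus>i\<in>{..<n}. (x \<otimes> (b i \<otimes> x [^] (n - Suc i))) \<otimes> w)"
  proof -
    have "x \<otimes> c = (\<Oplus>i\<in>{..<n}. x \<otimes> (b i \<otimes> x [^] (n - Suc i)))"
      unfolding c_def using b r x by (intro finsum_rdistr) auto
    then show ?thesis
      using b r x w by (simp add: finsum_ldistr Pi_def)
  qed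
  have "(x \<otimes> c) \<otimes> w \<ominus> r n \<otimes> x [^] n
      = (\<Oplus>i\<in>{..<n}. (x \<otimes> (b i \<otimes> x [^] (n - Suc i))) \<otimes> w \<oplus> (\<ominus> \<one>) \<otimes> ((b i \<otimes> r i) \<otimes> x [^] n))"
  proof -
    have "\<ominus> (r n \<otimes> x [^] n) = (\<ominus> \<one>) \<otimes> (r n \<otimes> x [^] n)"
      using r x by (simp add: l_minus)
    also have "\<dots> = (\<Oplus>i\<in>{..<n}. (\<ominus> \<one>) \<otimes> ((b i \<otimes> r i) \<otimes> x [^] n))"
      unfolding eq1 using b r x by (intro finsum_rdistr) auto
    finally show ?thesis
      unfolding a_minus_def eq2 using b r x w by (simp add: finsum_addf Pi_def)
  qed
  also have "\<dots> \<in> I"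
  proof (rule ideal_finsum[OF I])
    fix i assume "i \<in> {..<n}"
    then have i: "n = Suc (n - Suc i) + i"
      by auto
    have "x [^] n = x [^] (n - Suc i) \<otimes> x \<otimes> x [^] i"
      using x by (subst i, subst nat_pow_mult[symmetric]) auto
    then have "(x \<otimes> (b i \<otimes> x [^] (n - Suc i))) \<otimes> w \<oplus> (\<ominus> \<one>) \<otimes> ((b i \<otimes> r i) \<otimes> x [^] n)
        = (b i \<otimes> x [^] (n - Suc i) \<otimes> x) \<otimes> (w \<ominus> r i \<otimes> x [^] i)"
      using b(1) r(1) x w by (simp add: a_minus_def r_distr l_minus r_minus m_ac)
    then show "(x \<otimes> (b i \<otimes> x [^] (n - Suc i))) \<otimes> w \<oplus> (\<ominus> \<one>) \<otimes> ((b i \<otimes> r i) \<otimes> x [^] n) \<in> I"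
      using ideal.I_l_closed[OF I r(2)] b x by simp
  qed auto
  finally have "(x \<otimes> c) \<otimes> w \<ominus> r n \<otimes> x [^] n \<in> I" .
  then have "(w \<ominus> r n \<otimes> x [^] n) \<ominus> ((x \<otimes> c) \<otimes> w \<ominus> r n \<otimes> x [^] n) \<in> I"
    by (rule ideal_minus[OF I r(2)])
  also have "(w \<ominus> r n \<otimes> x [^] n) \<ominus> ((x \<otimes> c) \<otimes> w \<ominus> r n \<otimes> x [^] n) = w \<ominus> (x \<otimes> c) \<otimes> w"
    using c x w r(1) by (simp add: minus_minus_cancel)
  finally show thesis
    using that c by blast
qed

end

section \<open>Chains of ideals\<close>

context cring
begin

text \<open>
  A chain of \<open>k\<close> strict inclusions from \<open>A\<close> up to \<open>B\<close>; the largest possible \<open>k\<close> is the length of the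
  module \<open>B/A\<close>.  An explicit bound on \<open>k\<close> takes the place of this length.
\<close>
inductive ideal_chain :: "'a set \<Rightarrow> nat \<Rightarrow> 'a set \<Rightarrow> bool" where
  ideal_chain_refl: "ideal A R \<Longrightarrow> ideal_chain A 0 A"
| ideal_chain_step: "\<lbrakk>ideal A R; A \<subset> B; ideal_chain B k C\<rbrakk> \<Longrightarrow> ideal_chain A (Suc k) C"

lemma ideal_chainD:
  assumes "ideal_chain A k B"
  shows "ideal A R" "ideal B R" "A \<subseteq> B"
  using assms by (induction rule: ideal_chain.induct) auto

lemma ideal_chain_trans:
  "\<lbrakk>ideal_chain A k B; ideal_chain B l C\<rbrakk> \<Longrightarrow> ideal_chain A (k + l) C"
  by (induction rule: ideal_chain.induct) (auto intro: ideal_chain_step)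

lemma ideal_chain_single: "\<lbrakk>ideal A R; ideal B R; A \<subset> B\<rbrakk> \<Longrightarrow> ideal_chain A 1 B"
  using ideal_chain_step[OF _ _ ideal_chain_refl] by simp

lemma ideal_chain_same: "ideal_chain A k A \<Longrightarrow> k = 0"
  by (cases rule: ideal_chain.cases) (use ideal_chainD(3) in blast)+

text \<open>
  By the modular law, a strict inclusion stays strict under at least one of the two operations of
  intersecting with \<open>D\<close> and adding \<open>D\<close>; hence the length of a chain is at most the sum of the lengths of its two images.
\<close>
lemma ideal_chain_split:
  assumes "ideal_chain A k B" "ideal D R"
  obtains p q where "k \<le> p + q" "ideal_chain (A \<inter> D) p (B \<inter> D)"
    "ideal_chain (A <+>\<^bsub>R\<^esub> D) q (B <+>\<^bsub>R\<^esub> D)"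
proof -
  have "\<exists>p q. k \<le> p + q \<and> ideal_chain (A \<inter> D) p (B \<inter> D)
      \<and> ideal_chain (A <+>\<^bsub>R\<^esub> D) q (B <+>\<^bsub>R\<^esub> D)"
    using assms(1)
  proof (induction rule: ideal_chain.induct)
    case (ideal_chain_refl A)
    then show ?case
      using ideal_chain.ideal_chain_refl[OF i_intersect[OF _ assms(2)]]
        ideal_chain.ideal_chain_refl[OF add_ideals[OF _ assms(2)]] by blast
  next
    case (ideal_chain_step A A' k B)
    have A': "ideal A' R"
      using ideal_chainD ideal_chain_step.hyps by blast
    obtain p q where pq: "k \<le> p + q" "ideal_chain (A' \<inter> D) p (B \<inter> D)"
      "ideal_chain (A' <+>\<^bsub>R\<^esub> D) q (B <+>\<^bsub>R\<^esub> D)"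
      using ideal_chain_step.IH by blast
    have strict: "A \<inter> D \<subset> A' \<inter> D \<or> A <+>\<^bsub>R\<^esub> D \<subset> A' <+>\<^bsub>R\<^esub> D"
    proof (rule ccontr)
      assume neg: "\<not> ?thesis"
      have "A \<inter> D \<subseteq> A' \<inter> D" "A <+>\<^bsub>R\<^esub> D \<subseteq> A' <+>\<^bsub>R\<^esub> D"
        using ideal_chain_step.hyps ideal_sum_mono[of A A' D D] by auto
      then have eq: "A \<inter> D = A' \<inter> D" "A <+>\<^bsub>R\<^esub> D = A' <+>\<^bsub>R\<^esub> D"
        using neg by auto
      have "x \<in> A" if "x \<in> A'" for x
      proof -
        have "x \<in> A <+>\<^bsub>R\<^esub> D"
          using ideal_sum_upper(1)[OF A' assms(2)] that eq by blast
        then obtain a d where ad: "a \<in> A" "d \<in> D" "x = a \<oplus> d"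
          by (auto simp: mem_ideal_sum)
        have "a \<in> carrier R" "d \<in> carrier R"
          using ad ideal.Icarr[OF ideal_chain_step.hyps(1)] ideal.Icarr[OF assms(2)] by auto
        then have "d = x \<ominus> a"
          using ad(3) by (simp add: add_minus_cancel_left)
        moreover have "a \<in> A'"
          using ad(1) ideal_chain_step.hyps(2) by blast
        ultimately have "d \<in> A' \<inter> D"
          using ideal_minus[OF A' that] ad(2) by blast
        then have "d \<in> A"
          using eq by blast
        then show ?thesis
          using ad ideal_add[OF ideal_chain_step.hyps(1)] by blast
      qed
      then show False
        using ideal_chain_step.hyps(2) by blast
    qed
    have ideals: "ideal (A \<inter> D) R" "ideal (A <+>\<^bsub>R\<^esub> D) R"
      using i_intersect add_ideals ideal_chain_step.hyps(1) assms(2) by blast+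
    have lift: "\<exists>k'. k' \<ge> k \<and> (U \<subset> V \<longrightarrow> k' \<ge> Suc k) \<and> ideal_chain U k' W"
      if "ideal_chain V k W" "ideal U R" "U \<subseteq> V" for U V W k
    proof (cases "U = V")
      case True
      then show ?thesis using that by auto
    next
      case False
      then have "ideal_chain U (Suc k) W"
        using that by (intro ideal_chain.ideal_chain_step) auto
      then show ?thesis by (intro exI[of _ "Suc k"]) auto
    qed
    obtain p' where p': "p' \<ge> p" "A \<inter> D \<subset> A' \<inter> D \<longrightarrow> p' \<ge> Suc p"
      "ideal_chain (A \<inter> D) p' (B \<inter> D)"
      using lift[OF pq(2) ideals(1)] ideal_chain_step.hyps(2) by blast
    have "A <+>\<^bsub>R\<^esub> D \<subseteq> A' <+>\<^bsub>R\<^esub> D"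
      using ideal_chain_step.hyps ideal_sum_mono[of A A' D D] by auto
    then obtain q' where q': "q' \<ge> q" "A <+>\<^bsub>R\<^esub> D \<subset> A' <+>\<^bsub>R\<^esub> D \<longrightarrow> q' \<ge> Suc q"
      "ideal_chain (A <+>\<^bsub>R\<^esub> D) q' (B <+>\<^bsub>R\<^esub> D)"
      using lift[OF pq(3) ideals(2)] by blast
    have "Suc k \<le> p' + q'"
      using strict p'(1,2) q'(1,2) pq(1) by auto
    then show ?case
      using p'(3) q'(3) by blast
  qed
  then show thesis using that by blast
qed

text \<open>
  Inside \<open>aR\<close> every ideal \<open>A\<close> is \<open>a\<close> times \<open>(A : a)\<close>, so passing to colon ideals keeps the inclusions
  strict.
\<close>
lemma ideal_chain_unscale:
  assumes "ideal_chain A k B" "a \<in> carrier R" "B \<subseteq> (\<otimes>) a ` carrier R"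
  shows "ideal_chain (ideal_colon R A {a}) k (ideal_colon R B {a})"
  using assms(1,3)
proof (induction rule: ideal_chain.induct)
  case (ideal_chain_refl A)
  then show ?case
    by (intro ideal_chain.ideal_chain_refl ideal_colon_ideal) (use assms in auto)
next
  case (ideal_chain_step A A' k B)
  have "ideal_colon R A {a} \<subseteq> ideal_colon R A' {a}"
    using ideal_chain_step.hyps by (auto simp: ideal_colon_def)
  moreover obtain x where x: "x \<in> A'" "x \<notin> A"
    using ideal_chain_step.hyps by blast
  moreover have "A' \<subseteq> (\<otimes>) a ` carrier R"
    using ideal_chainD(3) ideal_chain_step by blast
  then obtain u where "u \<in> carrier R" "x = a \<otimes> u"
    using x by blast
  then have "u \<in> ideal_colon R A' {a}" "u \<notin> ideal_colon R A {a}"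
    using x assms(2) by (auto simp: ideal_colon_def m_comm[of u a])
  ultimately show ?case
    using ideal_chain_step assms(2)
    by (intro ideal_chain.ideal_chain_step ideal_colon_ideal) auto
qed

lemma ideal_colon_scaled:
  assumes "a \<in> nonzerodivisors R" "ideal I R"
  shows "ideal_colon R ((\<otimes>) a ` I) {a} = I"
proof
  have a: "a \<in> carrier R"
    using assms(1) by (rule nonzerodivisor_carrier)
  show "I \<subseteq> ideal_colon R ((\<otimes>) a ` I) {a}"
    using a ideal_subset[OF assms(2)] by (auto simp: ideal_colon_def m_comm[of _ a])
  show "ideal_colon R ((\<otimes>) a ` I) {a} \<subseteq> I"
  proof
    fix r assume r: "r \<in> ideal_colon R ((\<otimes>) a ` I) {a}"
    then obtain i where "i \<in> I" "a \<otimes> r = a \<otimes> i" "r \<in> carrier R"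
      using a by (auto simp: ideal_colon_def m_comm[of _ a])
    then show "r \<in> I"
      using nonzerodivisor_cancel[OF assms(1)] ideal.Icarr[OF assms(2)] by metis
  qed
qed

lemma longest_ideal_chain:
  assumes "ideal A R" "\<And>k. ideal_chain A k (carrier R) \<Longrightarrow> k \<le> e"
  obtains h where "ideal_chain A h (carrier R)" "\<And>k. ideal_chain A k (carrier R) \<Longrightarrow> k \<le> h"
proof -
  have "\<exists>k. ideal_chain A k (carrier R)"
  proof (cases "A = carrier R")
    case True
    then show ?thesis using ideal_chain_refl[OF oneideal] by blast
  next
    case False
    then show ?thesis
      using ideal_chain_single[OF assms(1) oneideal] ideal_subset[OF assms(1)] by blast
  qed
  then show thesis
    using that assms(2) GreatestI_ex_nat[of "\<lambda>k. ideal_chain A k (carrier R)" e]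
      Greatest_le_nat[of "\<lambda>k. ideal_chain A k (carrier R)" _ e] by blast
qed

text \<open>
  Multiplication by a nonzerodivisor \<open>a\<close> moves a chain from \<open>M\<close> to \<open>R\<close> to one from \<open>aM\<close> to \<open>aR\<close>.
  Comparing the two routes from \<open>aM\<close> to \<open>R\<close>, through \<open>M\<close> and through \<open>aR\<close>, shows that \<open>M/aM\<close>
  is no longer than \<open>R/aR\<close>.  More generators than this length cannot all be irredundant.
\<close>
lemma dependent_generator:
  fixes w :: "nat \<Rightarrow> 'a"
  assumes a: "a \<in> nonzerodivisors R" and w: "\<And>i. w i \<in> carrier R"
    and R_len: "\<And>k. ideal_chain ((\<otimes>) a ` carrier R) k (carrier R) \<Longrightarrow> k \<le> n"
    and M_len: "\<And>k. ideal_chain (Idl (w ` {..n})) k (carrier R) \<Longrightarrow> k \<le> e"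
  obtains j where "j \<le> n" "w j \<in> Idl (w ` {..<j}) <+>\<^bsub>R\<^esub> (\<otimes>) a ` (Idl (w ` {..n}))"
proof -
  define M where "M = Idl (w ` {..n})"
  define E where "E j = Idl (w ` {..<j}) <+>\<^bsub>R\<^esub> (\<otimes>) a ` M" for j
  have aR: "a \<in> carrier R"
    using a by (rule nonzerodivisor_carrier)
  have sub: "w ` A \<subseteq> carrier R" for A
    using w by blast
  have M: "ideal M R" and aM: "ideal ((\<otimes>) a ` M) R" and aM_sub: "(\<otimes>) a ` M \<subseteq> M"
    and aR_ideal: "ideal ((\<otimes>) a ` carrier R) R"
    unfolding M_def using genideal_ideal[OF sub] scaled_ideal[OF _ aR] oneideal
      scaled_ideal_subset[OF _ aR] by blast+
  have E: "ideal (E j) R" for j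
    unfolding E_def by (intro add_ideals genideal_ideal sub aM)
  have "\<exists>j\<le>n. w j \<in> E j"
  proof (rule ccontr)
    assume neg: "\<not> ?thesis"
    have strict: "E j \<subset> E (Suc j)" if "j \<le> n" for j
    proof -
      have "E j \<subseteq> E (Suc j)"
        unfolding E_def by (intro ideal_sum_mono subset_Idl_subset sub image_mono) auto
      moreover have "w j \<in> Idl (w ` {..<Suc j})"
        using genideal_self[OF sub] by blast
      then have "w j \<in> E (Suc j)"
        unfolding E_def using ideal_sum_upper(1)[OF genideal_ideal[OF sub] aM] by blast
      ultimately show ?thesis
        using neg that by blast
    qed
    have "ideal_chain (E 0) j (E j)" if "j \<le> Suc n" for j
      using that
    proof (induction j)
      case 0
      then show ?case using E ideal_chain_refl by blast
    next
      case (Suc j)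
      then show ?case
        using ideal_chain_trans[OF Suc.IH ideal_chain_single[OF E E strict]] by auto
    qed
    then have "ideal_chain (E 0) (Suc n) (E (Suc n))"
      by blast
    moreover have "E (Suc n) = M"
    proof
      show "E (Suc n) \<subseteq> M"
        unfolding E_def by (rule ideal_sum_least[OF M _ aM_sub]) (simp add: M_def lessThan_Suc_atMost)
      show "M \<subseteq> E (Suc n)"
        unfolding E_def using ideal_sum_upper(1)[OF genideal_ideal[OF sub] aM, of "{..<Suc n}"]
        by (simp add: M_def lessThan_Suc_atMost)
    qed
    moreover have "E 0 = (\<otimes>) a ` M"
    proof
      show "E 0 \<subseteq> (\<otimes>) a ` M"
        unfolding E_def by (rule ideal_sum_least[OF aM genideal_minimal[OF aM]]) auto
      show "(\<otimes>) a ` M \<subseteq> E 0"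
        unfolding E_def by (rule ideal_sum_upper(2)[OF genideal_ideal[OF sub] aM])
    qed
    ultimately have low: "ideal_chain ((\<otimes>) a ` M) (Suc n) M"
      by simp
    obtain h where h: "ideal_chain M h (carrier R)"
      "\<And>k. ideal_chain M k (carrier R) \<Longrightarrow> k \<le> h"
      using longest_ideal_chain[OF M] M_len unfolding M_def by blast
    obtain p q where pq: "Suc n + h \<le> p + q"
      "ideal_chain ((\<otimes>) a ` M \<inter> (\<otimes>) a ` carrier R) p (carrier R \<inter> (\<otimes>) a ` carrier R)"
      "ideal_chain ((\<otimes>) a ` M <+>\<^bsub>R\<^esub> (\<otimes>) a ` carrier R) q (carrier R <+>\<^bsub>R\<^esub> (\<otimes>) a ` carrier R)"
      by (rule ideal_chain_split[OF ideal_chain_trans[OF low h(1)] aR_ideal])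
    have M_sub: "(\<otimes>) a ` M \<subseteq> (\<otimes>) a ` carrier R"
      using ideal_subset[OF M] by blast
    have "(\<otimes>) a ` M \<inter> (\<otimes>) a ` carrier R = (\<otimes>) a ` M"
      "carrier R \<inter> (\<otimes>) a ` carrier R = (\<otimes>) a ` carrier R"
      using M_sub ideal_subset[OF aR_ideal] by blast+
    then have "ideal_chain ((\<otimes>) a ` M) p ((\<otimes>) a ` carrier R)"
      using pq(2) by simp
    then have "ideal_chain M p (carrier R)"
      using ideal_chain_unscale[OF _ aR] ideal_colon_scaled[OF a] M oneideal by fastforce
    then have "p \<le> h"
      by (rule h(2))
    have "(\<otimes>) a ` M <+>\<^bsub>R\<^esub> (\<otimes>) a ` carrier R = (\<otimes>) a ` carrier R"
      using ideal_sum_least[OF aR_ideal M_sub] ideal_sum_upper(2)[OF aM aR_ideal] by blast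
    moreover have "carrier R <+>\<^bsub>R\<^esub> (\<otimes>) a ` carrier R = carrier R"
      using ideal_sum_least[OF oneideal order_refl ideal_subset[OF aR_ideal]]
        ideal_sum_upper(1)[OF oneideal aR_ideal] by blast
    ultimately have "q \<le> n"
      using pq(3) R_len by simp
    then show False
      using pq(1) \<open>p \<le> h\<close> by simp
  qed
  then show thesis
    using that unfolding E_def M_def by blast
qed

end

section \<open>Noetherian local rings\<close>

sublocale noetherian_local_ring \<subseteq> noetherian_cring ..

context noetherian_local_ring
begin

lemma max_ideal: "ideal \<mm> R"
  by (rule is_ideal)

lemma one_notin_max: "\<one> \<notin> \<mm>"
  using one_imp_carrier I_notcarr by blast

lemma proper_ideal_subset_max:
  assumes "ideal I R" "I \<noteq> carrier R"
  shows "I \<subseteq> \<mm>"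
proof -
  let ?S = "{J. ideal J R \<and> I \<subseteq> J \<and> J \<noteq> carrier R}"
  obtain M where M: "M \<in> ?S" "\<And>J. \<lbrakk>J \<in> ?S; M \<subseteq> J\<rbrakk> \<Longrightarrow> J = M"
    by (rule maximal_ideal_of_family[of ?S]) (use assms in auto)
  have "maximalideal M R"
  proof (rule maximalidealI)
    fix J assume "ideal J R" "M \<subseteq> J"
    then show "J = M \<or> J = carrier R"
      using M by (cases "J = carrier R") auto
  qed (use M in auto)
  then show ?thesis
    using unique_maximal M(1) by blast
qed

lemma invertible_outside_max:
  assumes "u \<in> carrier R" "u \<notin> \<mm>"
  obtains v where "v \<in> carrier R" "v \<otimes> u = \<one>"
proof -
  have "PIdl u = carrier R"
    using proper_ideal_subset_max[OF cgenideal_ideal] cgenideal_self assms by blast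
  then have "\<one> \<in> PIdl u"
    by simp
  then show thesis
    using that by (auto simp: cgenideal_def)
qed

lemma cancel_outside_max:
  assumes "ideal I R" "u \<in> carrier R" "u \<notin> \<mm>" "x \<in> carrier R" "u \<otimes> x \<in> I"
  shows "x \<in> I"
proof -
  obtain v where v: "v \<in> carrier R" "v \<otimes> u = \<one>"
    using invertible_outside_max assms by blast
  have "v \<otimes> (u \<otimes> x) \<in> I"
    using ideal.I_l_closed[OF assms(1,5) v(1)] .
  moreover have "v \<otimes> (u \<otimes> x) = (v \<otimes> u) \<otimes> x"
    using v(1) assms by (simp add: m_assoc)
  ultimately show ?thesis
    using v assms by simp
qed

lemma outside_max_minus:
  assumes "u \<in> carrier R" "u \<notin> \<mm>" "x \<in> \<mm>"
  shows "u \<ominus> x \<notin> \<mm>"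
proof
  assume "u \<ominus> x \<in> \<mm>"
  then have "(u \<ominus> x) \<oplus> x \<in> \<mm>"
    using assms(3) ideal_add[OF max_ideal] by blast
  then show False
    using assms Icarr[OF assms(3)] by (simp add: a_minus_def a_assoc l_neg)
qed

text \<open>
  The module \<open>(D + Rz)/D\<close> is a quotient of the residue field, hence simple or zero.
\<close>
lemma simple_extension_chain:
  assumes "ideal D R" "z \<in> carrier R" "\<mm> \<subseteq> ideal_colon R D {z}"
    and "ideal_chain D k (D <+>\<^bsub>R\<^esub> PIdl z)"
  shows "k \<le> 1"
proof -
  let ?E = "D <+>\<^bsub>R\<^esub> PIdl z"
  have top: "C = ?E" if C: "ideal C R" "D \<subset> C" "C \<subseteq> ?E" for C
  proof -
    obtain c where c: "c \<in> C" "c \<notin> D"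
      using C by blast
    then obtain d r where dr: "d \<in> D" "r \<in> carrier R" "c = d \<oplus> r \<otimes> z"
      using C(3) by (fastforce simp: mem_ideal_sum cgenideal_def)
    have carr: "d \<in> carrier R" "c \<in> carrier R"
      using dr c ideal.Icarr[OF assms(1)] ideal.Icarr[OF C(1)] by auto
    have "r \<notin> \<mm>"
    proof
      assume "r \<in> \<mm>"
      then have "r \<otimes> z \<in> D"
        using assms(3) by (auto simp: ideal_colon_def)
      then show False
        using c dr ideal_add[OF assms(1)] by blast
    qed
    have "r \<otimes> z = c \<ominus> d"
      using dr carr assms(2) by (simp add: add_minus_cancel_left)
    then have "r \<otimes> z \<in> C"
      using ideal_minus[OF C(1) c(1)] dr(1) C(2) by auto
    then have "z \<in> C"
      using cancel_outside_max[OF C(1) dr(2) \<open>r \<notin> \<mm>\<close> assms(2)] by blast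
    then have "PIdl z \<subseteq> C"
      by (rule cgenideal_minimal[OF C(1)])
    then have "?E \<subseteq> C"
      using ideal_sum_least[OF C(1)] C(2) by blast
    then show ?thesis
      using C(3) by blast
  qed
  show ?thesis
    using assms(4)
  proof (cases rule: ideal_chain.cases)
    case (ideal_chain_step B k')
    then have "B = ?E"
      using top ideal_chainD by blast
    then show ?thesis
      using ideal_chain_step ideal_chain_same by auto
  qed auto
qed

end

section \<open>Dimension at most one\<close>

locale noetherian_local_ring_dim_le_one = noetherian_local_ring +
  assumes dim_le_one: "krull_dim R \<le> 1"
begin

text \<open>
  The multiplicative set generated by \<open>x\<close> and the complement of \<open>P\<close> omits \<open>0\<close>, since \<open>x\<close> is a
  nonzerodivisor.  A prime avoiding it lies strictly below \<open>P\<close>, leaving no room between \<open>P\<close> and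
  the maximal ideal.
\<close>
lemma regular_prime_is_max:
  assumes P: "primeideal P R" and x: "x \<in> P" "x \<in> nonzerodivisors R"
  shows "P = \<mm>"
proof (rule ccontr)
  assume neq: "P \<noteq> \<mm>"
  have PI: "ideal P R" and P_ne: "P \<noteq> carrier R"
    and P_prime: "\<And>a b. \<lbrakk>a \<in> carrier R; b \<in> carrier R; a \<otimes> b \<in> P\<rbrakk> \<Longrightarrow> a \<in> P \<or> b \<in> P"
    using primeideal.axioms(1)[OF P] primeideal.I_notcarr[OF P] primeideal.I_prime[OF P]
    by auto
  have xR: "x \<in> carrier R"
    using x(2) by (rule nonzerodivisor_carrier)
  have one_P: "\<one> \<notin> P"
    using ideal.one_imp_carrier[OF PI] P_ne by blast
  define T where "T = {x [^] n \<otimes> s | (n::nat) s. s \<in> carrier R - P}"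
  have T_zero: "\<zero> \<notin> T"
  proof
    assume "\<zero> \<in> T"
    then obtain n :: nat and s where s: "s \<in> carrier R" "s \<notin> P" "x [^] n \<otimes> s = \<zero>"
      unfolding T_def by auto
    then have "s = \<zero>"
      using nonzerodivisorD[OF nonzerodivisor_pow[OF x(2)]] by blast
    then show False
      using s(2) ideal_zero[OF PI] by blast
  qed
  have T_mult: "s \<otimes> t \<in> T" if "s \<in> T" "t \<in> T" for s t
  proof -
    obtain n k :: nat and p q where *: "p \<in> carrier R" "p \<notin> P" "s = x [^] n \<otimes> p"
      "q \<in> carrier R" "q \<notin> P" "t = x [^] k \<otimes> q"
      using \<open>s \<in> T\<close> \<open>t \<in> T\<close> unfolding T_def by auto
    have "s \<otimes> t = (x [^] n \<otimes> x [^] k) \<otimes> (p \<otimes> q)"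
      using * xR by (simp add: m_ac)
    also have "\<dots> = x [^] (n + k) \<otimes> (p \<otimes> q)"
      using xR by (simp add: nat_pow_mult)
    finally show ?thesis
      unfolding T_def using * P_prime by blast
  qed
  have T_P: "s \<in> T" if "s \<in> carrier R - P" for s
    unfolding T_def using that by (intro CollectI exI[of _ "0::nat"] exI[of _ s]) auto
  have T_one: "\<one> \<in> T"
    using T_P one_P by simp
  have T_sub: "T \<subseteq> carrier R"
    unfolding T_def using xR by auto
  have "{\<zero>} \<inter> T = {}"
    using T_zero by blast
  then obtain Q where Q: "primeideal Q R" "Q \<inter> T = {}"
    using prime_avoiding_mult_set[OF T_sub T_mult T_one zeroideal] by metis
  have "Q \<subseteq> P"
    using T_P Q ideal_subset[OF primeideal.axioms(1)[OF Q(1)]] by blast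
  moreover have "x \<in> T"
    unfolding T_def using xR one_P
    by (intro CollectI exI[of _ "1::nat"] exI[of _ "\<one>"]) auto
  ultimately have QP: "Q \<subset> P"
    using x(1) Q(2) by blast
  have Pm: "P \<subset> \<mm>"
    using proper_ideal_subset_max[OF PI P_ne] neq by blast
  have "primeideal \<mm> R"
    by (rule maximalideal_prime[OF is_maximalideal])
  then have "enat 2 \<le> krull_dim R"
    unfolding krull_dim_def using Q(1) P QP Pm
    by (intro Sup_upper CollectI exI[of _ 2] conjI refl
        exI[of _ "\<lambda>i::nat. if i = 0 then Q else if i = 1 then P else \<mm>"]) auto
  also have "\<dots> \<le> enat 1"
    using dim_le_one by (simp add: one_enat_def)
  finally show False
    by simp
qed

text \<open>
  An associated prime of \<open>R/D\<close> contains the nonzerodivisor \<open>d\<close>, so it can only be \<open>\<mm>\<close>.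
\<close>
lemma regular_ideal_socle:
  assumes "ideal D R" "D \<noteq> carrier R" "d \<in> D" "d \<in> nonzerodivisors R"
  obtains z where "z \<in> carrier R" "z \<notin> D" "ideal_colon R D {z} = \<mm>"
proof -
  obtain z where z: "z \<in> carrier R" "z \<notin> D" "primeideal (ideal_colon R D {z}) R"
    using associated_prime_exists[OF assms(1,2)] .
  moreover have "d \<in> ideal_colon R D {z}"
    using assms(3) z(1) ideal.I_r_closed[OF assms(1)] ideal.Icarr[OF assms(1)]
    by (auto simp: ideal_colon_def)
  ultimately show thesis
    using that regular_prime_is_max assms(4) by blast
qed

text \<open>
  Consider a maximal counterexample among the ideals containing \<open>d\<close>.  Adjoining to it an element \<open>z\<close>
  that \<open>\<mm>\<close> multiplies into it lowers the length of the quotient by only one.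
\<close>
lemma regular_ideal_finite_length:
  assumes "ideal D R" "d \<in> D" "d \<in> nonzerodivisors R"
  obtains e where "\<And>k. ideal_chain D k (carrier R) \<Longrightarrow> k \<le> e"
proof -
  define fin where "fin D \<longleftrightarrow> (\<exists>e. \<forall>k. ideal_chain D k (carrier R) \<longrightarrow> k \<le> e)" for D
  have "fin D"
  proof (rule ccontr)
    assume "\<not> fin D"
    let ?S = "{D. ideal D R \<and> d \<in> D \<and> \<not> fin D}"
    obtain M where M: "M \<in> ?S" "\<And>J. \<lbrakk>J \<in> ?S; M \<subseteq> J\<rbrakk> \<Longrightarrow> J = M"
      by (rule maximal_ideal_of_family[of ?S]) (use assms \<open>\<not> fin D\<close> in auto)
    have MI: "ideal M R"
      using M by blast
    have "fin (carrier R)"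
      unfolding fin_def using ideal_chain_same by fastforce
    then have "M \<noteq> carrier R"
      using M by blast
    then obtain z where z: "z \<in> carrier R" "z \<notin> M" "ideal_colon R M {z} = \<mm>"
      using regular_ideal_socle[OF MI] M(1) assms(3) by blast
    define E where "E = M <+>\<^bsub>R\<^esub> PIdl z"
    have E: "ideal E R" "M \<subseteq> E" "z \<in> E"
      unfolding E_def using add_ideals[OF MI cgenideal_ideal[OF z(1)]]
        ideal_sum_upper[OF MI cgenideal_ideal[OF z(1)]] cgenideal_self[OF z(1)] by auto
    then have "fin E"
      using M z(2) by blast
    then obtain e where e: "\<And>k. ideal_chain E k (carrier R) \<Longrightarrow> k \<le> e"
      unfolding fin_def by blast
    have "k \<le> 1 + e" if k: "ideal_chain M k (carrier R)" for k
    proof -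
      obtain p q where pq: "k \<le> p + q" "ideal_chain (M \<inter> E) p (carrier R \<inter> E)"
        "ideal_chain (M <+>\<^bsub>R\<^esub> E) q (carrier R <+>\<^bsub>R\<^esub> E)"
        by (rule ideal_chain_split[OF k E(1)])
      have "M \<inter> E = M" "carrier R \<inter> E = E"
        using E ideal_subset[OF E(1)] by auto
      then have "p \<le> 1"
        using simple_extension_chain[OF MI z(1), of p] z(3) pq(2) by (simp add: E_def)
      moreover have "M <+>\<^bsub>R\<^esub> E = E"
        using ideal_sum_least[OF E(1,2)] ideal_sum_upper(2)[OF MI E(1)] by blast
      moreover have "carrier R <+>\<^bsub>R\<^esub> E = carrier R"
        using ideal_sum_least[OF oneideal order_refl ideal_subset[OF E(1)]]
          ideal_sum_upper(1)[OF oneideal E(1)] by blast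
      ultimately show ?thesis
        using e pq by fastforce
    qed
    then have "fin M"
      unfolding fin_def by blast
    then show False
      using M by blast
  qed
  then show thesis
    using that unfolding fin_def by blast
qed

end

section \<open>Values of monic polynomials\<close>

context cring
begin

text \<open>
  The value at \<open>t\<close> of the monic polynomial of degree \<open>j\<close> whose lower coefficients are \<open>- r\<^sub>i\<close>.
\<close>
definition monic_value :: "(nat \<Rightarrow> 'a) \<Rightarrow> nat \<Rightarrow> 'a \<Rightarrow> 'a" where
  "monic_value r j t = t [^] j \<ominus> (\<Oplus>i\<in>{..<j}. r i \<otimes> t [^] i)"

lemma finsum_lessThan_Suc_shift:
  assumes "\<And>i. f i \<in> carrier R"
  shows "(\<Oplus>i\<in>{..<Suc j}. f i) = f 0 \<oplus> (\<Oplus>i\<in>{..<j}. f (Suc i))"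
proof (induction j)
  case 0
  then show ?case using assms by (simp add: lessThan_Suc)
next
  case (Suc j)
  have "(\<Oplus>i\<in>{..<Suc (Suc j)}. f i) = f (Suc j) \<oplus> (\<Oplus>i\<in>{..<Suc j}. f i)"
    using assms by (subst lessThan_Suc) (simp add: Pi_def)
  also have "\<dots> = f 0 \<oplus> (f (Suc j) \<oplus> (\<Oplus>i\<in>{..<j}. f (Suc i)))"
    unfolding Suc.IH using assms by (simp add: a_lcomm Pi_def)
  finally show ?case
    using assms by (simp add: lessThan_Suc[of j] Pi_def)
qed

lemma monic_value_closed:
  assumes "\<And>i. r i \<in> carrier R" "t \<in> carrier R"
  shows "monic_value r j t \<in> carrier R"
  using assms by (simp add: monic_value_def Pi_def)

lemma monic_value_0: "t \<in> carrier R \<Longrightarrow> monic_value r 0 t = \<one>"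
  by (simp add: monic_value_def a_minus_def)

lemma monic_value_Suc:
  assumes r: "\<And>i. r i \<in> carrier R" and t: "t \<in> carrier R"
  shows "monic_value r (Suc j) t = t \<otimes> monic_value (\<lambda>i. r (Suc i)) j t \<ominus> r 0"
proof -
  have "(\<Oplus>i\<in>{..<Suc j}. r i \<otimes> t [^] i) = r 0 \<oplus> (\<Oplus>i\<in>{..<j}. t \<otimes> (r (Suc i) \<otimes> t [^] i))"
    using r t by (subst finsum_lessThan_Suc_shift) (simp_all add: m_ac)
  also have "\<dots> = r 0 \<oplus> t \<otimes> (\<Oplus>i\<in>{..<j}. r (Suc i) \<otimes> t [^] i)"
    using r t by (simp add: finsum_rdistr Pi_def)
  finally show ?thesis
    using r t by (simp add: monic_value_def a_minus_def minus_add r_distr r_minus m_comm a_ac Pi_def)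
qed

text \<open>
  \<open>T - s\<close> divides \<open>f(T) - f(s)\<close>, and the quotient is again monic.  It depends on \<open>s\<close> but not on the
  point \<open>t\<close> of evaluation, which is what an induction on the degree needs.
\<close>
lemma monic_value_difference:
  assumes "\<And>i. r i \<in> carrier R" "s \<in> carrier R"
  shows "\<exists>q. (\<forall>i. q i \<in> carrier R) \<and> (\<forall>t\<in>carrier R.
    monic_value r (Suc j) t \<ominus> monic_value r (Suc j) s = (t \<ominus> s) \<otimes> monic_value q j t)"
  using assms(1)
proof (induction j arbitrary: r)
  case 0
  then show ?case
    using assms(2)
    by (intro exI[of _ r])
      (auto simp: monic_value_Suc monic_value_0 minus_minus_cancel)
next
  case (Suc j)
  let ?r = "\<lambda>i. r (Suc i)"
  obtain q where q: "\<And>i. q i \<in> carrier R" "\<And>t. t \<in> carrier R \<Longrightarrow>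
      monic_value ?r (Suc j) t \<ominus> monic_value ?r (Suc j) s = (t \<ominus> s) \<otimes> monic_value q j t"
    using Suc.IH[of ?r] Suc.prems by blast
  define v where "v = monic_value ?r (Suc j) s"
  have v: "v \<in> carrier R"
    unfolding v_def using Suc.prems assms(2) by (simp add: monic_value_closed)
  let ?q = "\<lambda>i. case i of 0 \<Rightarrow> \<ominus> v | Suc i \<Rightarrow> q i"
  have q': "?q i \<in> carrier R" for i
    using q(1) v by (cases i) auto
  have "monic_value r (Suc (Suc j)) t \<ominus> monic_value r (Suc (Suc j)) s
      = (t \<ominus> s) \<otimes> monic_value ?q (Suc j) t" if t: "t \<in> carrier R" for t
  proof -
    define u where "u = monic_value ?r (Suc j) t"
    define m where "m = monic_value q j t"
    have um: "u \<in> carrier R" "m \<in> carrier R"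
      unfolding u_def m_def using Suc.prems q(1) t by (simp_all add: monic_value_closed)
    have uv: "u \<ominus> v = (t \<ominus> s) \<otimes> m"
      unfolding u_def v_def m_def by (rule q(2)[OF t])
    have "monic_value r (Suc (Suc j)) t \<ominus> monic_value r (Suc (Suc j)) s = t \<otimes> u \<ominus> s \<otimes> v"
      using monic_value_Suc[of r t "Suc j", OF Suc.prems t]
        monic_value_Suc[of r s "Suc j", OF Suc.prems assms(2)] t assms(2) um v Suc.prems
      by (simp add: minus_minus_cancel u_def[symmetric] v_def[symmetric])
    also have "\<dots> = t \<otimes> (u \<ominus> v) \<oplus> (t \<ominus> s) \<otimes> v"
    proof -
      have "t \<otimes> (u \<ominus> v) \<oplus> (t \<ominus> s) \<otimes> v = (t \<otimes> u \<ominus> s \<otimes> v) \<oplus> (t \<otimes> v \<ominus> t \<otimes> v)"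
        using t assms(2) um v
        by (simp add: a_minus_def l_distr r_distr l_minus r_minus a_ac)
      also have "t \<otimes> v \<ominus> t \<otimes> v = \<zero>"
        using t v by (simp add: a_minus_def r_neg)
      finally show ?thesis
        using t assms(2) um v by simp
    qed
    also have "\<dots> = (t \<ominus> s) \<otimes> (t \<otimes> m \<oplus> v)"
      unfolding uv using t assms(2) um v by (simp add: r_distr m_lcomm)
    also have "t \<otimes> m \<oplus> v = monic_value ?q (Suc j) t"
      using monic_value_Suc[of ?q t j, OF q' t] t um v by (simp add: m_def a_minus_def)
    finally show ?thesis .
  qed
  then show ?case
    using q' by (intro exI[of _ ?q]) blast
qed

text \<open>
  Over an integral domain a monic polynomial of degree \<open>j\<close> has at most \<open>j\<close> roots: divide off
  the factor belonging to one root.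
\<close>
lemma finite_monic_roots_mod_prime:
  assumes P: "primeideal P R" and r: "\<And>i. r i \<in> carrier R"
  shows "finite ((\<lambda>t. P +> t) ` {t \<in> carrier R. monic_value r j t \<in> P})"
  using r
proof (induction j arbitrary: r)
  case 0
  have "\<one> \<notin> P"
    using primeideal.I_notcarr[OF P] ideal.one_imp_carrier[OF primeideal.axioms(1)[OF P]] by auto
  then have "{t \<in> carrier R. monic_value r 0 t \<in> P} = {}"
    by (auto simp: monic_value_0)
  then show ?case
    by (metis finite.emptyI image_empty)
next
  case (Suc j)
  have PI: "ideal P R"
    using P by (rule primeideal.axioms(1))
  let ?roots = "\<lambda>r j. {t \<in> carrier R. monic_value r j t \<in> P}"
  show ?case
  proof (cases "?roots r (Suc j) = {}")
    case True
    then show ?thesis by (metis finite.emptyI image_empty)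
  next
    case False
    then obtain s where s: "s \<in> carrier R" "monic_value r (Suc j) s \<in> P"
      by blast
    obtain q where q: "\<And>i. q i \<in> carrier R" "\<And>t. t \<in> carrier R \<Longrightarrow>
        monic_value r (Suc j) t \<ominus> monic_value r (Suc j) s = (t \<ominus> s) \<otimes> monic_value q j t"
      using monic_value_difference[of r s j] Suc.prems s(1) by blast
    have "P +> t \<in> insert (P +> s) ((\<lambda>t. P +> t) ` ?roots q j)" if t: "t \<in> ?roots r (Suc j)" for t
    proof -
      have "(t \<ominus> s) \<otimes> monic_value q j t \<in> P"
        using q(2)[of t] t ideal_minus[OF PI _ s(2), of "monic_value r (Suc j) t"] by simp
      then consider "t \<ominus> s \<in> P" | "monic_value q j t \<in> P"
        using primeideal.I_prime[OF P, of "t \<ominus> s" "monic_value q j t"] t s(1) q(1)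
        by (auto simp: monic_value_closed)
      then show ?thesis
      proof cases
        case 1
        then have "P +> t = P +> s"
          using quotient_eq_iff_same_a_r_cos[OF PI] t s(1) by blast
        then show ?thesis by simp
      next
        case 2
        then show ?thesis using t by blast
      qed
    qed
    then have "(\<lambda>t. P +> t) ` ?roots r (Suc j) \<subseteq> insert (P +> s) ((\<lambda>t. P +> t) ` ?roots q j)"
      by (rule image_subsetI)
    moreover have "finite ((\<lambda>t. P +> t) ` ?roots q j)"
      by (rule Suc.IH[OF q(1)])
    ultimately show ?thesis
      by (meson finite.insertI finite_subset)
  qed
qed

lemma monic_value_outside_prime:
  assumes "primeideal P R" "infinite (carrier (R Quot P))" "\<And>i. r i \<in> carrier R"
  obtains t where "t \<in> carrier R" "monic_value r j t \<notin> P"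
proof -
  have "carrier (R Quot P) = (\<lambda>t. P +> t) ` carrier R"
    by (auto simp: FactRing_def A_RCOSETS_def')
  then have "{t \<in> carrier R. monic_value r j t \<in> P} \<noteq> carrier R"
    using finite_monic_roots_mod_prime[of P r j, OF assms(1,3)] assms(2) by metis
  then show thesis
    using that by blast
qed

end

section \<open>Reductions of regular ideals\<close>

context cring
begin

text \<open>
  The nonzerodivisor makes \<open>M\<close> a faithful module, so that fractions multiplying \<open>M\<close> into itself are
  integral.
\<close>
definition regular_ideal :: "'a set \<Rightarrow> bool" where
  "regular_ideal M \<longleftrightarrow> ideal M R \<and> (\<exists>g\<in>M. g \<in> nonzerodivisors R)"

lemma regular_ideal_ideal: "regular_ideal M \<Longrightarrow> ideal M R"
  by (simp add: regular_ideal_def)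

lemma regular_ideal_carrier: "regular_ideal (carrier R)"
  unfolding regular_ideal_def using oneideal nonzerodivisor_one by blast

lemma regular_ideal_prod:
  assumes "regular_ideal M" "regular_ideal N"
  shows "regular_ideal (M \<cdot> N)"
proof -
  obtain g h where "g \<in> M" "h \<in> N" "g \<in> nonzerodivisors R" "h \<in> nonzerodivisors R"
    using assms by (auto simp: regular_ideal_def)
  then have "g \<otimes> h \<in> M \<cdot> N" "g \<otimes> h \<in> nonzerodivisors R"
    by (auto intro: ideal_prod.prod nonzerodivisor_mult)
  then show ?thesis
    using assms ideal_prod_is_ideal unfolding regular_ideal_def by blast
qed

lemma ideal_prod_mult_closed:
  assumes "ideal I R" "ideal J R" "ideal K R" "u \<in> carrier R"
    and "\<And>i j. \<lbrakk>i \<in> I; j \<in> J\<rbrakk> \<Longrightarrow> u \<otimes> (i \<otimes> j) \<in> K" and "x \<in> I \<cdot> J"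
  shows "u \<otimes> x \<in> K"
  using assms(6)
proof (induction x rule: ideal_prod.induct)
  case (prod i j)
  then show ?case using assms(5) by blast
next
  case (sum s t)
  have "s \<in> carrier R" "t \<in> carrier R"
    using sum.hyps ideal_prod_in_carrier[OF assms(1,2)] by blast+
  then show ?case
    using sum.IH ideal_add[OF assms(3)] assms(4) by (simp add: r_distr)
qed

end

context noetherian_local_ring_dim_le_one
begin

text \<open>
  Take \<open>N\<close> to be at least the length of \<open>R/aR\<close>, let \<open>M = (a, b)\<^sup>N\<close> and \<open>c = a - t b\<close>, and put
  \<open>E = c M\<close>.  By \<open>dependent_generator\<close> some monomial \<open>a\<^sup>j b\<^sup>N\<^sup>+\<^sup>1\<^sup>-\<^sup>j\<close> is a combination of those with smaller
  exponent of \<open>a\<close>, up to an element of \<open>a (a, b)\<^sup>N\<^sup>+\<^sup>1\<close>.  Modulo \<open>E\<close> the element \<open>a\<close> acts on \<open>M\<close> as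
  \<open>t b\<close>, so each monomial \<open>a\<^sup>i b\<^sup>N\<^sup>+\<^sup>1\<^sup>-\<^sup>i\<close> is congruent to \<open>t\<^sup>i b\<^sup>N\<^sup>+\<^sup>1\<close>, and the relation becomes
  \<open>(f(t) - a s) b\<^sup>N\<^sup>+\<^sup>1 \<in> E\<close> for a monic polynomial \<open>f\<close>.  If \<open>f(t) \<notin> \<mm>\<close>, the first factor is a unit;
  hence \<open>b\<^sup>N\<^sup>+\<^sup>1\<close> and with it all of \<open>(a, b)\<^sup>N\<^sup>+\<^sup>1\<close> lies in \<open>E\<close>.
\<close>
lemma two_generator_reduction:
  assumes a: "a \<in> nonzerodivisors R" "a \<in> \<mm>" and b: "b \<in> \<mm>"
    and inf: "infinite (carrier (R Quot \<mm>))"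
  obtains c M where "c \<in> Idl {a, b}" "regular_ideal M"
    "(\<otimes>) a ` M \<subseteq> (\<otimes>) c ` M" "(\<otimes>) b ` M \<subseteq> (\<otimes>) c ` M"
proof -
  have aR: "a \<in> carrier R" and bR: "b \<in> carrier R"
    using a b Icarr by auto
  have "a \<in> (\<otimes>) a ` carrier R"
    using aR by (auto intro!: image_eqI[of _ _ "\<one>"])
  then obtain N where N: "\<And>k. ideal_chain ((\<otimes>) a ` carrier R) k (carrier R) \<Longrightarrow> k \<le> N"
    by (rule regular_ideal_finite_length[OF scaled_ideal[OF oneideal aR] _ a(1)]) (rule that)
  define e where "e i = a [^] i \<otimes> b [^] (Suc N - i)" for i
  define f where "f i = a [^] i \<otimes> b [^] (N - i)" for i
  have eR: "e i \<in> carrier R" and fR: "f i \<in> carrier R" for i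
    unfolding e_def f_def using aR bR by auto
  have e_sub: "e ` A \<subseteq> carrier R" and f_sub: "f ` A \<subseteq> carrier R" for A
    using eR fR by auto
  have a_f: "a \<otimes> f i = e (Suc i)" for i
    unfolding e_def f_def using aR bR by (simp add: m_ac)
  have b_f: "b \<otimes> f i = e i" if "i \<le> N" for i
    unfolding e_def f_def using aR bR that by (simp add: Suc_diff_le m_ac)
  have e_self: "e (Suc N) \<in> Idl (e ` {..Suc N})"
    using genideal_self[OF e_sub, of "{..Suc N}"] by blast
  have e_nzd: "e (Suc N) \<in> nonzerodivisors R"
    unfolding e_def using nonzerodivisor_pow[OF a(1), of "Suc N"] aR by simp
  obtain L where L: "\<And>k. ideal_chain (Idl (e ` {..Suc N})) k (carrier R) \<Longrightarrow> k \<le> L"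
    by (rule regular_ideal_finite_length[OF genideal_ideal[OF e_sub] e_self e_nzd]) (rule that)
  obtain j where j: "j \<le> Suc N"
    "e j \<in> Idl (e ` {..<j}) <+>\<^bsub>R\<^esub> (\<otimes>) a ` (Idl (e ` {..Suc N}))"
    by (rule dependent_generator[of a e "Suc N" L, OF a(1) eR])
      (erule le_SucI[OF N], erule L, rule that)
  then obtain p u where pu: "p \<in> Idl (e ` {..<j})" "u \<in> Idl (e ` {..Suc N})" "e j = p \<oplus> a \<otimes> u"
    by (auto simp: mem_ideal_sum)
  obtain r where r: "\<And>i. r i \<in> carrier R" "p = (\<Oplus>i\<in>{..<j}. r i \<otimes> e i)"
    by (rule Idl_image_combination[OF _ pu(1)]) (auto intro: eR that)
  have "primeideal \<mm> R"
    by (rule maximalideal_prime[OF is_maximalideal])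
  then obtain t where t: "t \<in> carrier R" "monic_value r j t \<notin> \<mm>"
    by (rule monic_value_outside_prime[OF _ inf r(1)])
  define c where "c = a \<ominus> t \<otimes> b"
  have cR: "c \<in> carrier R"
    unfolding c_def using aR bR t by simp
  define M where "M = Idl (f ` {..N})"
  define E where "E = (\<otimes>) c ` M"
  define B where "B = b [^] Suc N"
  have M: "ideal M R" and E: "ideal E R" and BR: "B \<in> carrier R"
    unfolding M_def E_def B_def using genideal_ideal[OF f_sub] scaled_ideal[OF _ cR] bR by auto
  have f_M: "f i \<in> M" if "i \<le> N" for i
    unfolding M_def using genideal_self[OF f_sub, of "{..N}"] that by auto
  have e_mod: "e i \<ominus> t [^] i \<otimes> B \<in> E" if "i \<le> Suc N" for i
    using that
  proof (induction i)
    case 0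
    have "e 0 = B"
      unfolding e_def B_def using bR by simp
    then show ?case
      using BR ideal_zero[OF E] by (simp add: a_minus_def r_neg)
  next
    case (Suc i)
    have "e (Suc i) = c \<otimes> f i \<oplus> t \<otimes> e i"
    proof -
      have "c \<otimes> f i \<oplus> t \<otimes> e i = (a \<otimes> f i \<ominus> t \<otimes> (b \<otimes> f i)) \<oplus> t \<otimes> (b \<otimes> f i)"
        unfolding c_def using Suc.prems b_f[of i] aR bR t fR[of i]
        by (simp add: a_minus_def l_distr l_minus m_assoc)
      also have "\<dots> = a \<otimes> f i"
        using aR bR t fR[of i] by (simp add: a_minus_def a_assoc l_neg)
      finally show ?thesis
        using a_f by simp
    qed
    then have "e (Suc i) \<ominus> t [^] Suc i \<otimes> B = c \<otimes> f i \<oplus> t \<otimes> (e i \<ominus> t [^] i \<otimes> B)"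
      using cR t fR eR BR by (simp add: a_minus_def r_distr r_minus a_assoc m_ac)
    also have "\<dots> \<in> E"
    proof (rule ideal_add[OF E])
      show "c \<otimes> f i \<in> E"
        unfolding E_def using f_M Suc.prems by simp
      show "t \<otimes> (e i \<ominus> t [^] i \<otimes> B) \<in> E"
        using Suc ideal.I_l_closed[OF E _ t(1)] by simp
    qed
    finally show ?case .
  qed
  define Q where "Q = E <+>\<^bsub>R\<^esub> PIdl B"
  have Q: "ideal Q R"
    unfolding Q_def by (rule add_ideals[OF E cgenideal_ideal[OF BR]])
  have "e i \<in> Q" if "i \<le> Suc N" for i
  proof -
    have "e i = (e i \<ominus> t [^] i \<otimes> B) \<oplus> t [^] i \<otimes> B"
      using eR t BR by (simp add: a_minus_def a_assoc l_neg)
    moreover have "t [^] i \<otimes> B \<in> PIdl B"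
      unfolding cgenideal_def using t by blast
    ultimately show ?thesis
      unfolding Q_def mem_ideal_sum using e_mod[OF that] by blast
  qed
  then have "Idl (e ` {..Suc N}) \<subseteq> Q"
    by (intro genideal_minimal[OF Q]) auto
  then obtain x s where xs: "x \<in> E" "s \<in> carrier R" "u = x \<oplus> s \<otimes> B"
    using pu(2) unfolding Q_def by (fastforce simp: mem_ideal_sum cgenideal_def)
  have xR: "x \<in> carrier R"
    using xs(1) ideal.Icarr[OF E] by blast
  define \<rho> where "\<rho> = (\<Oplus>i\<in>{..<j}. r i \<otimes> t [^] i)"
  have \<rho>R: "\<rho> \<in> carrier R"
    unfolding \<rho>_def using r t by (simp add: Pi_def)
  have pR: "p \<in> carrier R"
    unfolding r(2) using r(1) eR by (simp add: Pi_def)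
  have p_mod: "p \<ominus> \<rho> \<otimes> B \<in> E"
  proof -
    have "\<ominus> (\<rho> \<otimes> B) = \<rho> \<otimes> (\<ominus> B)"
      using \<rho>R BR by (simp add: r_minus)
    also have "\<dots> = (\<Oplus>i\<in>{..<j}. (r i \<otimes> t [^] i) \<otimes> (\<ominus> B))"
      unfolding \<rho>_def using r t BR by (intro finsum_ldistr) auto
    finally have "p \<ominus> \<rho> \<otimes> B = (\<Oplus>i\<in>{..<j}. r i \<otimes> e i \<oplus> (r i \<otimes> t [^] i) \<otimes> (\<ominus> B))"
      unfolding a_minus_def r(2) using r(1) t eR BR by (simp add: finsum_addf Pi_def)
    also have "\<dots> \<in> E"
    proof (rule ideal_finsum[OF E])
      fix i assume "i \<in> {..<j}"
      then have "r i \<otimes> (e i \<ominus> t [^] i \<otimes> B) \<in> E"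
        using ideal.I_l_closed[OF E e_mod r(1)] j(1) by simp
      then show "r i \<otimes> e i \<oplus> (r i \<otimes> t [^] i) \<otimes> (\<ominus> B) \<in> E"
        using r(1) eR t BR by (simp add: a_minus_def r_distr r_minus m_assoc)
    qed simp
    finally show ?thesis .
  qed
  \<comment> \<open>Subtracting the congruences for \<open>e\<^sub>j\<close>, \<open>p\<close> and \<open>u\<close> from \<open>e\<^sub>j = p + a u\<close> leaves \<open>(f(t) - a s) B \<in> E\<close>.\<close>
  have "(monic_value r j t \<ominus> a \<otimes> s) \<otimes> B \<in> E"
  proof -
    have "(p \<ominus> \<rho> \<otimes> B) \<oplus> a \<otimes> x \<ominus> (e j \<ominus> t [^] j \<otimes> B) \<in> E"
      using ideal_minus[OF E ideal_add[OF E p_mod ideal.I_l_closed[OF E xs(1) aR]] e_mod[OF j(1)]] .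
    also have "(p \<ominus> \<rho> \<otimes> B) \<oplus> a \<otimes> x \<ominus> (e j \<ominus> t [^] j \<otimes> B)
        = (monic_value r j t \<ominus> a \<otimes> s) \<otimes> B \<oplus> ((p \<oplus> a \<otimes> x) \<ominus> (p \<oplus> a \<otimes> x))"
      unfolding pu(3) xs(3) monic_value_def \<rho>_def[symmetric]
      using pR \<rho>R BR aR xR xs(2) t(1)
      by (simp add: a_minus_def minus_add l_distr r_distr l_minus r_minus m_ac a_ac)
    also have "\<dots> = (monic_value r j t \<ominus> a \<otimes> s) \<otimes> B"
      using pR BR aR xR xs(2) t(1) r(1) by (simp add: a_minus_def r_neg monic_value_closed)
    finally show ?thesis .
  qed
  moreover have "monic_value r j t \<ominus> a \<otimes> s \<notin> \<mm>"
    using outside_max_minus t r(1) I_r_closed[OF a(2) xs(2)] by (simp add: monic_value_closed)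
  moreover have "monic_value r j t \<ominus> a \<otimes> s \<in> carrier R"
    using t(1) r(1) aR xs(2) by (simp add: monic_value_closed)
  ultimately have "B \<in> E"
    using cancel_outside_max[OF E _ _ BR] by blast
  have e_E: "e i \<in> E" if "i \<le> Suc N" for i
  proof -
    have "(e i \<ominus> t [^] i \<otimes> B) \<oplus> t [^] i \<otimes> B \<in> E"
      using ideal_add[OF E e_mod[OF that]] ideal.I_l_closed[OF E \<open>B \<in> E\<close>] t(1) by simp
    then show ?thesis
      using eR t(1) BR by (simp add: a_minus_def a_assoc l_neg)
  qed
  have "a \<otimes> s \<in> E" "b \<otimes> s \<in> E" if "s \<in> f ` {..N}" for s
    using that a_f b_f e_E by auto
  then have "(\<otimes>) a ` M \<subseteq> E" "(\<otimes>) b ` M \<subseteq> E"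
    using Idl_mult_closed[OF E f_sub aR] Idl_mult_closed[OF E f_sub bR] unfolding M_def by blast+
  moreover have "f N \<in> nonzerodivisors R"
    unfolding f_def using nonzerodivisor_pow[OF a(1)] aR by simp
  then have "regular_ideal M"
    unfolding regular_ideal_def using M f_M by blast
  moreover have "c \<in> Idl {a, b}"
  proof -
    have ab: "ideal (Idl {a, b}) R" "{a, b} \<subseteq> Idl {a, b}"
      using genideal_ideal[of "{a, b}"] genideal_self[of "{a, b}"] aR bR by auto
    then show ?thesis
      unfolding c_def using ideal_minus[OF ab(1)] ideal.I_l_closed[OF ab(1)] t(1) by simp
  qed
  ultimately show thesis
    using that unfolding E_def by blast
qed

text \<open>
  The generators are absorbed one at a time.  If \<open>c\<close> serves the earlier ones with the ideal \<open>M\<close>, and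
  \<open>c'\<close> serves \<open>c\<close> and \<open>b\<close> with \<open>M'\<close>, then \<open>c'\<close> serves all of them with \<open>M M'\<close>: from \<open>u M \<subseteq> c M\<close> and
  \<open>c M' \<subseteq> c' M'\<close> follows \<open>u M M' \<subseteq> c' M M'\<close>.
\<close>
lemma reduction_of_finite_set:
  assumes "finite A" "A \<subseteq> \<mm>" and a: "a \<in> nonzerodivisors R" "a \<in> \<mm>"
    and inf: "infinite (carrier (R Quot \<mm>))"
  obtains c M where "c \<in> Idl (insert a A)" "c \<in> nonzerodivisors R" "regular_ideal M"
    "\<And>u. u \<in> insert a A \<Longrightarrow> (\<otimes>) u ` M \<subseteq> (\<otimes>) c ` M"
proof -
  have "\<exists>c M. c \<in> Idl (insert a A) \<and> c \<in> nonzerodivisors R \<and> regular_ideal M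
      \<and> (\<forall>u\<in>insert a A. (\<otimes>) u ` M \<subseteq> (\<otimes>) c ` M)"
    using assms(1,2)
  proof (induction A rule: finite_induct)
    case empty
    then show ?case
      using a genideal_self'[of a] Icarr regular_ideal_carrier by blast
  next
    case (insert b A)
    obtain c M where IH: "c \<in> Idl (insert a A)" "c \<in> nonzerodivisors R" "regular_ideal M"
      "\<And>u. u \<in> insert a A \<Longrightarrow> (\<otimes>) u ` M \<subseteq> (\<otimes>) c ` M"
      using insert.IH insert.prems by (metis insert_subset)
    have sub: "insert a (insert b A) \<subseteq> \<mm>"
      using a insert.prems by blast
    have subR: "insert a (insert b A) \<subseteq> carrier R"
      using sub Icarr by blast
    have "Idl (insert a A) \<subseteq> \<mm>"
      by (rule genideal_minimal[OF max_ideal]) (use sub in blast)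
    then have cm: "c \<in> \<mm>" and bm: "b \<in> \<mm>"
      using IH(1) insert.prems by auto
    obtain c' M' where new: "c' \<in> Idl {c, b}" "regular_ideal M'"
      "(\<otimes>) c ` M' \<subseteq> (\<otimes>) c' ` M'" "(\<otimes>) b ` M' \<subseteq> (\<otimes>) c' ` M'"
      using two_generator_reduction[OF IH(2) cm bm inf] .
    have carr: "c \<in> carrier R" "b \<in> carrier R"
      using cm bm Icarr by auto
    let ?I = "Idl (insert a (insert b A))"
    have I: "ideal ?I R"
      by (rule genideal_ideal[OF subR])
    have "Idl (insert a A) \<subseteq> ?I"
      by (rule subset_Idl_subset[OF subR]) blast
    moreover have "b \<in> ?I"
      using genideal_self[OF subR] by blast
    ultimately have "Idl {c, b} \<subseteq> ?I"
      using IH(1) by (intro genideal_minimal[OF I]) auto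
    then have c'I: "c' \<in> ?I"
      using new(1) by blast
    then have c'R: "c' \<in> carrier R"
      using ideal.Icarr[OF I] by blast
    have MI: "ideal M R" "ideal M' R"
      using IH(3) new(2) regular_ideal_ideal by auto
    obtain g where g: "g \<in> M'" "g \<in> nonzerodivisors R"
      using new(2) by (auto simp: regular_ideal_def)
    then obtain h where h: "h \<in> M'" "c \<otimes> g = c' \<otimes> h"
      using new(3) by blast
    have "c' \<otimes> h \<in> nonzerodivisors R"
      using h(2) nonzerodivisor_mult[OF IH(2) g(2)] by simp
    then have c'_nzd: "c' \<in> nonzerodivisors R"
      using nonzerodivisor_factor c'R h(1) ideal.Icarr[OF MI(2)] by blast
    have P: "ideal (M \<cdot> M') R" "regular_ideal (M \<cdot> M')"
      using regular_ideal_prod[OF IH(3) new(2)] regular_ideal_ideal by auto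
    have c'P: "ideal ((\<otimes>) c' ` (M \<cdot> M')) R"
      by (rule scaled_ideal[OF P(1) c'R])
    have "(\<otimes>) u ` (M \<cdot> M') \<subseteq> (\<otimes>) c' ` (M \<cdot> M')" if u: "u \<in> insert a (insert b A)" for u
    proof (rule image_subsetI)
      have uR: "u \<in> carrier R"
        using u subR by blast
      fix x assume x: "x \<in> M \<cdot> M'"
      show "u \<otimes> x \<in> (\<otimes>) c' ` (M \<cdot> M')"
      proof (rule ideal_prod_mult_closed[OF MI c'P uR _ x])
        fix v v' assume v: "v \<in> M" "v' \<in> M'"
        have vR: "v \<in> carrier R" "v' \<in> carrier R"
          using v ideal.Icarr[OF MI(1)] ideal.Icarr[OF MI(2)] by auto
        have "\<exists>w\<in>M. \<exists>w'\<in>M'. u \<otimes> (v \<otimes> v') = c' \<otimes> (w \<otimes> w')"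
        proof (cases "u = b")
          case True
          then obtain w' where w': "w' \<in> M'" "u \<otimes> v' = c' \<otimes> w'"
            using new(4) v by blast
          have "u \<otimes> (v \<otimes> v') = v \<otimes> (u \<otimes> v')"
            using uR vR by (simp add: m_lcomm)
          also have "\<dots> = c' \<otimes> (v \<otimes> w')"
            unfolding w'(2) using vR c'R ideal.Icarr[OF MI(2) w'(1)] by (simp add: m_lcomm)
          finally show ?thesis
            using v w' by blast
        next
          case False
          then obtain w where w: "w \<in> M" "u \<otimes> v = c \<otimes> w"
            using IH(4) u v by blast
          obtain w' where w': "w' \<in> M'" "c \<otimes> v' = c' \<otimes> w'"
            using new(3) v by blast
          have wR: "w \<in> carrier R" "w' \<in> carrier R"
            using w w' ideal.Icarr[OF MI(1)] ideal.Icarr[OF MI(2)] by auto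
          have "u \<otimes> (v \<otimes> v') = (u \<otimes> v) \<otimes> v'"
            using uR vR by (simp add: m_assoc)
          also have "\<dots> = w \<otimes> (c \<otimes> v')"
            unfolding w(2) using wR carr vR by (simp add: m_ac)
          also have "\<dots> = c' \<otimes> (w \<otimes> w')"
            unfolding w'(2) using wR c'R by (simp add: m_lcomm)
          finally show ?thesis
            using w w' by blast
        qed
        then show "u \<otimes> (v \<otimes> v') \<in> (\<otimes>) c' ` (M \<cdot> M')"
          by (auto intro!: image_eqI ideal_prod.prod)
      qed
    qed
    then show ?case
      using c'I c'_nzd P(2) by blast
  qed
  then show thesis
    using that by blast
qed

text \<open>
  Northcott and Rees' theorem on minimal reductions in dimension one, stated through a multiplier
  ideal: every fraction \<open>u/c\<close> with \<open>u \<in> I\<close> multiplies \<open>M\<close> into itself.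
\<close>
lemma principal_reduction:
  assumes "regular_ideal I" "I \<noteq> carrier R" and inf: "infinite (carrier (R Quot \<mm>))"
  obtains c M where "c \<in> I" "c \<in> nonzerodivisors R" "regular_ideal M"
    "\<And>u. u \<in> I \<Longrightarrow> (\<otimes>) u ` M \<subseteq> (\<otimes>) c ` M"
proof -
  have I: "ideal I R" and Im: "I \<subseteq> \<mm>"
    using assms regular_ideal_ideal proper_ideal_subset_max by auto
  obtain a where a: "a \<in> I" "a \<in> nonzerodivisors R"
    using assms(1) by (auto simp: regular_ideal_def)
  obtain A where A: "A \<subseteq> carrier R" "finite A" "I = Idl A"
    using finetely_gen[OF I] by blast
  have AI: "A \<subseteq> I"
    using genideal_self[OF A(1)] A(3) by simp
  have aA: "insert a A \<subseteq> I"
    using a AI by blast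
  obtain c M where cM: "c \<in> Idl (insert a A)" "c \<in> nonzerodivisors R" "regular_ideal M"
    "\<And>u. u \<in> insert a A \<Longrightarrow> (\<otimes>) u ` M \<subseteq> (\<otimes>) c ` M"
    using reduction_of_finite_set[OF A(2) _ a(2) _ inf] AI Im a(1) by blast
  have "c \<in> I"
    using cM(1) genideal_minimal[OF I aA] by blast
  have M: "ideal M R"
    by (rule regular_ideal_ideal[OF cM(3)])
  have cR: "c \<in> carrier R"
    by (rule nonzerodivisor_carrier[OF cM(2)])
  have "(\<otimes>) u ` M \<subseteq> (\<otimes>) c ` M" if u: "u \<in> I" for u
  proof (rule image_subsetI)
    fix v assume v: "v \<in> M"
    have vR: "v \<in> carrier R"
      using v ideal.Icarr[OF M] by blast
    have "v \<otimes> u \<in> (\<otimes>) c ` M"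
    proof (rule Idl_mult_closed[OF scaled_ideal[OF M cR] A(1) vR])
      show "u \<in> Idl A"
        using u A(3) by simp
      fix s assume s: "s \<in> A"
      then have "s \<otimes> v \<in> (\<otimes>) c ` M"
        using cM(4) v by blast
      then show "v \<otimes> s \<in> (\<otimes>) c ` M"
        using s A(1) vR by (simp add: m_comm[of v] subset_iff)
    qed
    then show "u \<otimes> v \<in> (\<otimes>) c ` M"
      using vR ideal.Icarr[OF I u] by (simp add: m_comm)
  qed
  then show thesis
    using that \<open>c \<in> I\<close> cM by blast
qed

end

section \<open>Integral fractions\<close>

context cring
begin

text \<open>
  The integrality of the fraction \<open>y/c\<close> over \<open>R\<close>, with denominators cleared, so that it can be
  discussed inside \<open>R\<close>.
\<close>
definition integral_fraction :: "'a \<Rightarrow> 'a \<Rightarrow> bool" where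
  "integral_fraction y c \<longleftrightarrow> (\<exists>n\<ge>1::nat. \<exists>a. (\<forall>i\<in>{1..n}. a i \<in> carrier R) \<and>
     y [^] n \<oplus> (\<Oplus>i\<in>{1..n}. (a i \<otimes> c [^] i) \<otimes> y [^] (n - i)) = \<zero>)"

text \<open>
  In the total ring of fractions the left-hand side is, up to the unit \<open>c\<^sup>n\<close>, the image of the
  right-hand side.
\<close>
lemma clear_denominators:
  fixes n :: nat
  assumes y: "y \<in> carrier R" and c: "c \<in> nonzerodivisors R"
    and a: "\<And>i. i \<in> {1..n} \<Longrightarrow> a i \<in> carrier R"
  shows "loc_frac R (nonzerodivisors R) y c [^]\<^bsub>total_fractions R\<^esub> n
      \<oplus>\<^bsub>total_fractions R\<^esub> (\<Oplus>\<^bsub>total_fractions R\<^esub>i\<in>{1..n}. to_fractions R (a i)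
        \<otimes>\<^bsub>total_fractions R\<^esub> loc_frac R (nonzerodivisors R) y c [^]\<^bsub>total_fractions R\<^esub> (n - i))
      = \<zero>\<^bsub>total_fractions R\<^esub>
    \<longleftrightarrow> y [^] n \<oplus> (\<Oplus>i\<in>{1..n}. (a i \<otimes> c [^] i) \<otimes> y [^] (n - i)) = \<zero>"
proof -
  let ?S = "nonzerodivisors R"
  let ?Q = "total_fractions R"
  let ?f = "to_fractions R"
  define u where "u = loc_frac R ?S y c"
  define v where "v = loc_frac R ?S \<one> c"
  interpret S: mult_subset R ?S by (rule nonzerodivisors_mult_subset)
  interpret Q: cring ?Q by (rule total_fractions_cring)
  interpret f: ring_hom_cring R ?Q ?f
    by (intro ring_hom_cring.intro is_cring Q.is_cring ring_hom_cring_axioms.intro to_fractions_hom)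
  have cR: "c \<in> carrier R"
    using c by (rule nonzerodivisor_carrier)
  have uQ: "u \<in> carrier ?Q" and vQ: "v \<in> carrier ?Q"
    unfolding u_def v_def total_fractions_def using y c by simp_all
  have cu: "?f c \<otimes>\<^bsub>?Q\<^esub> u = ?f y"
  proof -
    have "?f c \<otimes>\<^bsub>?Q\<^esub> u = loc_frac R ?S (c \<otimes> y) (\<one> \<otimes> c)"
      unfolding u_def to_fractions_def total_fractions_def
      by (rule S.loc_mult_frac) (use y c cR S.S_one in auto)
    also have "\<dots> = ?f y"
      unfolding to_fractions_def
      by (rule S.loc_frac_eqI) (use y c cR S.S_one in \<open>simp_all add: m_comm\<close>)
    finally show ?thesis .
  qed
  have vc: "v \<otimes>\<^bsub>?Q\<^esub> ?f c = \<one>\<^bsub>?Q\<^esub>"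
  proof -
    have "v \<otimes>\<^bsub>?Q\<^esub> ?f c = loc_frac R ?S (\<one> \<otimes> c) (c \<otimes> \<one>)"
      unfolding v_def to_fractions_def total_fractions_def
      by (rule S.loc_mult_frac) (use c cR S.S_one in auto)
    also have "\<dots> = \<one>\<^bsub>?Q\<^esub>"
      unfolding total_fractions_def S.loc_one
      by (rule S.loc_frac_eqI) (use c cR S.S_one in simp_all)
    finally show ?thesis .
  qed
  have pow: "?f c [^]\<^bsub>?Q\<^esub> k \<otimes>\<^bsub>?Q\<^esub> u [^]\<^bsub>?Q\<^esub> k = ?f (y [^] k)" for k :: nat
    using uQ cR y cu by (simp add: Q.nat_pow_distrib[symmetric] f.hom_pow)
  define E where "E = u [^]\<^bsub>?Q\<^esub> n
    \<oplus>\<^bsub>?Q\<^esub> (\<Oplus>\<^bsub>?Q\<^esub>i\<in>{1..n}. ?f (a i) \<otimes>\<^bsub>?Q\<^esub> u [^]\<^bsub>?Q\<^esub> (n - i))"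
  define F where "F = y [^] n \<oplus> (\<Oplus>i\<in>{1..n}. (a i \<otimes> c [^] i) \<otimes> y [^] (n - i))"
  have EQ: "E \<in> carrier ?Q"
    unfolding E_def using uQ a by (auto intro!: Q.a_closed Q.finsum_closed)
  have FR: "F \<in> carrier R"
    unfolding F_def using y cR a by (auto intro!: a_closed finsum_closed)
  have "?f c [^]\<^bsub>?Q\<^esub> n \<otimes>\<^bsub>?Q\<^esub> E = ?f F"
  proof -
    have "?f c [^]\<^bsub>?Q\<^esub> n \<otimes>\<^bsub>?Q\<^esub> E = ?f (y [^] n)
      \<oplus>\<^bsub>?Q\<^esub> (\<Oplus>\<^bsub>?Q\<^esub>i\<in>{1..n}. ?f c [^]\<^bsub>?Q\<^esub> n \<otimes>\<^bsub>?Q\<^esub> (?f (a i) \<otimes>\<^bsub>?Q\<^esub> u [^]\<^bsub>?Q\<^esub> (n - i)))"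
      unfolding E_def using uQ cR a pow[of n]
      by (subst Q.r_distr) (auto intro!: Q.finsum_closed simp: Q.finsum_rdistr Pi_def)
    also have "(\<Oplus>\<^bsub>?Q\<^esub>i\<in>{1..n}. ?f c [^]\<^bsub>?Q\<^esub> n \<otimes>\<^bsub>?Q\<^esub> (?f (a i) \<otimes>\<^bsub>?Q\<^esub> u [^]\<^bsub>?Q\<^esub> (n - i)))
      = (\<Oplus>\<^bsub>?Q\<^esub>i\<in>{1..n}. ?f ((a i \<otimes> c [^] i) \<otimes> y [^] (n - i)))"
    proof (rule Q.finsum_cong')
      fix i assume i: "i \<in> {1..n}"
      have "?f c [^]\<^bsub>?Q\<^esub> n = ?f c [^]\<^bsub>?Q\<^esub> i \<otimes>\<^bsub>?Q\<^esub> ?f c [^]\<^bsub>?Q\<^esub> (n - i)"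
        using i cR by (simp add: Q.nat_pow_mult)
      then have "?f c [^]\<^bsub>?Q\<^esub> n \<otimes>\<^bsub>?Q\<^esub> (?f (a i) \<otimes>\<^bsub>?Q\<^esub> u [^]\<^bsub>?Q\<^esub> (n - i))
        = (?f (a i) \<otimes>\<^bsub>?Q\<^esub> ?f c [^]\<^bsub>?Q\<^esub> i)
          \<otimes>\<^bsub>?Q\<^esub> (?f c [^]\<^bsub>?Q\<^esub> (n - i) \<otimes>\<^bsub>?Q\<^esub> u [^]\<^bsub>?Q\<^esub> (n - i))"
        using uQ cR a[OF i] by (simp add: Q.m_ac)
      also have "\<dots> = ?f ((a i \<otimes> c [^] i) \<otimes> y [^] (n - i))"
        unfolding pow using cR y a[OF i] by (simp add: f.hom_pow)
      finally show "?f c [^]\<^bsub>?Q\<^esub> n \<otimes>\<^bsub>?Q\<^esub> (?f (a i) \<otimes>\<^bsub>?Q\<^esub> u [^]\<^bsub>?Q\<^esub> (n - i))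
        = ?f ((a i \<otimes> c [^] i) \<otimes> y [^] (n - i))" .
    qed (use cR y a in auto)
    also have "\<dots> = ?f (\<Oplus>i\<in>{1..n}. (a i \<otimes> c [^] i) \<otimes> y [^] (n - i))"
      using cR y a by (subst f.hom_finsum) (auto simp: comp_def)
    also have "?f (y [^] n) \<oplus>\<^bsub>?Q\<^esub> \<dots> = ?f F"
      unfolding F_def using cR y a by (subst f.hom_add) (auto intro!: finsum_closed)
    finally show ?thesis .
  qed
  moreover have "E = v [^]\<^bsub>?Q\<^esub> n \<otimes>\<^bsub>?Q\<^esub> (?f c [^]\<^bsub>?Q\<^esub> n \<otimes>\<^bsub>?Q\<^esub> E)"
    using vQ cR EQ vc by (simp add: Q.m_assoc[symmetric] Q.nat_pow_distrib[symmetric])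
  ultimately have "E = v [^]\<^bsub>?Q\<^esub> n \<otimes>\<^bsub>?Q\<^esub> ?f F" "?f F = ?f c [^]\<^bsub>?Q\<^esub> n \<otimes>\<^bsub>?Q\<^esub> E"
    by simp_all
  then have "E = \<zero>\<^bsub>?Q\<^esub> \<longleftrightarrow> ?f F = \<zero>\<^bsub>?Q\<^esub>"
    using vQ cR by (metis Q.nat_pow_closed Q.r_null f.hom_closed)
  also have "\<dots> \<longleftrightarrow> F = \<zero>"
    using to_fractions_inj FR by (metis f.hom_zero inj_onD zero_closed)
  finally show ?thesis
    unfolding E_def F_def u_def .
qed

lemma fraction_in_integral_closure_iff:
  assumes y: "y \<in> carrier R" and c: "c \<in> nonzerodivisors R"
  shows "loc_frac R (nonzerodivisors R) y c \<in> ring_integral_closure R \<longleftrightarrow> integral_fraction y c"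
proof
  interpret S: mult_subset R "nonzerodivisors R" by (rule nonzerodivisors_mult_subset)
  assume "loc_frac R (nonzerodivisors R) y c \<in> ring_integral_closure R"
  then obtain n :: nat and b where n: "n \<ge> 1"
    and b: "\<forall>i\<in>{1..n}. b i \<in> to_fractions R ` carrier R"
    and eq: "loc_frac R (nonzerodivisors R) y c [^]\<^bsub>total_fractions R\<^esub> n
      \<oplus>\<^bsub>total_fractions R\<^esub> (\<Oplus>\<^bsub>total_fractions R\<^esub>i\<in>{1..n}. b i
        \<otimes>\<^bsub>total_fractions R\<^esub> loc_frac R (nonzerodivisors R) y c [^]\<^bsub>total_fractions R\<^esub> (n - i))
      = \<zero>\<^bsub>total_fractions R\<^esub>"
    unfolding ring_integral_closure_def integral_closure_in_def
    by (elim CollectE conjE exE) (rule that; assumption)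
  interpret Q: cring "total_fractions R" by (rule total_fractions_cring)
  have uQ: "loc_frac R (nonzerodivisors R) y c \<in> carrier (total_fractions R)"
    unfolding total_fractions_def using y c by simp
  have fQ: "to_fractions R x \<in> carrier (total_fractions R)" if "x \<in> carrier R" for x
    using to_fractions_hom that by (rule ring_hom_closed)
  have "\<forall>i\<in>{1..n}. \<exists>x. x \<in> carrier R \<and> b i = to_fractions R x"
    using b by fast
  from bchoice[OF this] obtain a
    where a: "\<And>i. i \<in> {1..n} \<Longrightarrow> a i \<in> carrier R \<and> b i = to_fractions R (a i)"
    by blast
  have "(\<Oplus>\<^bsub>total_fractions R\<^esub>i\<in>{1..n}. b i
        \<otimes>\<^bsub>total_fractions R\<^esub> loc_frac R (nonzerodivisors R) y c [^]\<^bsub>total_fractions R\<^esub> (n - i))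
      = (\<Oplus>\<^bsub>total_fractions R\<^esub>i\<in>{1..n}. to_fractions R (a i)
        \<otimes>\<^bsub>total_fractions R\<^esub> loc_frac R (nonzerodivisors R) y c [^]\<^bsub>total_fractions R\<^esub> (n - i))"
    using a uQ fQ by (intro Q.finsum_cong') auto
  then have "y [^] n \<oplus> (\<Oplus>i\<in>{1..n}. (a i \<otimes> c [^] i) \<otimes> y [^] (n - i)) = \<zero>"
    using eq clear_denominators[OF y c, of n a] a by auto
  then show "integral_fraction y c"
    unfolding integral_fraction_def using n a by blast
next
  interpret S: mult_subset R "nonzerodivisors R" by (rule nonzerodivisors_mult_subset)
  assume "integral_fraction y c"
  then obtain n :: nat and a where n: "n \<ge> 1" and a: "\<And>i. i \<in> {1..n} \<Longrightarrow> a i \<in> carrier R"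
    and eq: "y [^] n \<oplus> (\<Oplus>i\<in>{1..n}. (a i \<otimes> c [^] i) \<otimes> y [^] (n - i)) = \<zero>"
    unfolding integral_fraction_def by blast
  have "loc_frac R (nonzerodivisors R) y c \<in> carrier (total_fractions R)"
    unfolding total_fractions_def using y c by simp
  then show "loc_frac R (nonzerodivisors R) y c \<in> ring_integral_closure R"
    unfolding ring_integral_closure_def integral_closure_in_def
    using n a iffD2[OF clear_denominators[of y c n a, OF y c a] eq]
    by (intro CollectI conjI exI[of _ n] exI[of _ "\<lambda>i. to_fractions R (a i)"]) auto
qed

text \<open>
  From here on the conductor is handled without the total ring of fractions.
\<close>
lemma mem_conductor_iff:
  "r \<in> conductor R \<longleftrightarrow> r \<in> carrier R \<and>
    (\<forall>y\<in>carrier R. \<forall>c\<in>nonzerodivisors R. integral_fraction y c \<longrightarrow> r \<otimes> y \<in> (\<otimes>) c ` carrier R)"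
proof -
  let ?S = "nonzerodivisors R"
  interpret S: mult_subset R ?S by (rule nonzerodivisors_mult_subset)
  have mult: "to_fractions R r \<otimes>\<^bsub>total_fractions R\<^esub> loc_frac R ?S y c
        \<in> to_fractions R ` carrier R \<longleftrightarrow> r \<otimes> y \<in> (\<otimes>) c ` carrier R"
    if "r \<in> carrier R" "y \<in> carrier R" "c \<in> ?S" for r y c
  proof -
    have cR: "c \<in> carrier R"
      using that(3) by (rule nonzerodivisor_carrier)
    have prod: "to_fractions R r \<otimes>\<^bsub>total_fractions R\<^esub> loc_frac R ?S y c = loc_frac R ?S (r \<otimes> y) c"
      unfolding to_fractions_def total_fractions_def
      using that S.S_one cR by (simp add: S.loc_mult_frac)
    have "loc_frac R ?S (r \<otimes> y) c = to_fractions R s \<longleftrightarrow> r \<otimes> y = c \<otimes> s" if s: "s \<in> carrier R" for s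
    proof
      assume "loc_frac R ?S (r \<otimes> y) c = to_fractions R s"
      then obtain t where t: "t \<in> ?S" "t \<otimes> (r \<otimes> y \<otimes> \<one>) = t \<otimes> (s \<otimes> c)"
        unfolding to_fractions_def
        using s that S.S_one \<open>r \<in> carrier R\<close> \<open>y \<in> carrier R\<close> \<open>c \<in> ?S\<close>
        by (auto simp: S.loc_frac_eq_iff)
      then show "r \<otimes> y = c \<otimes> s"
        using nonzerodivisor_cancel[OF t(1), of "r \<otimes> y" "s \<otimes> c"] s cR
          \<open>r \<in> carrier R\<close> \<open>y \<in> carrier R\<close> by (simp add: m_comm[of s c])
    next
      assume "r \<otimes> y = c \<otimes> s"
      then show "loc_frac R ?S (r \<otimes> y) c = to_fractions R s"
        unfolding to_fractions_def
        using s that S.S_one \<open>r \<in> carrier R\<close> \<open>y \<in> carrier R\<close> \<open>c \<in> ?S\<close> cR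
        by (intro S.loc_frac_eqI) (auto simp: m_comm)
    qed
    then show ?thesis
      unfolding prod by (auto simp: image_iff)
  qed
  have R_bar: "ring_integral_closure R
      = {loc_frac R ?S y c | y c. y \<in> carrier R \<and> c \<in> ?S \<and> integral_fraction y c}" (is "_ = ?B")
  proof
    show "ring_integral_closure R \<subseteq> ?B"
    proof
      fix U assume U: "U \<in> ring_integral_closure R"
      then have "U \<in> carrier (localization R ?S)"
        by (simp add: ring_integral_closure_def integral_closure_in_def total_fractions_def)
      then obtain y c where "y \<in> carrier R" "c \<in> ?S" "U = loc_frac R ?S y c"
        by (rule S.loc_cases)
      then show "U \<in> ?B"
        using U fraction_in_integral_closure_iff by blast
    qed
    show "?B \<subseteq> ring_integral_closure R"
      by (auto simp: fraction_in_integral_closure_iff)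
  qed
  show ?thesis
    unfolding conductor_def R_bar using mult by blast
qed

end

section \<open>Stable ideals and integral closure\<close>

context cring
begin

lemma ideal_power_ideal:
  assumes "ideal I R"
  shows "ideal (I [^]\<^bsub>ideals_set R\<^esub> (n::nat)) R"
  by (induction n) (use assms oneideal ideal_prod_is_ideal in \<open>auto simp: ideals_set_def\<close>)

lemma ideal_power_Suc: "I [^]\<^bsub>ideals_set R\<^esub> Suc n = (I [^]\<^bsub>ideals_set R\<^esub> n) \<cdot> I"
  by (simp add: ideals_set_def)

lemma ideal_power_0: "I [^]\<^bsub>ideals_set R\<^esub> (0::nat) = carrier R"
  by (simp add: ideals_set_def)

lemma pow_mem_ideal_power: "c \<in> I \<Longrightarrow> c [^] n \<in> I [^]\<^bsub>ideals_set R\<^esub> (n::nat)"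
proof (induction n)
  case 0
  show ?case
    unfolding ideal_power_0 by simp
next
  case (Suc n)
  then show ?case
    by (subst ideal_power_Suc) (simp add: ideal_prod.prod)
qed

lemma ideal_power_mono: "I \<subseteq> J \<Longrightarrow> I [^]\<^bsub>ideals_set R\<^esub> n \<subseteq> J [^]\<^bsub>ideals_set R\<^esub> (n::nat)"
proof (induction n)
  case (Suc n)
  show ?case
    unfolding ideal_power_Suc
  proof
    fix x assume "x \<in> (I [^]\<^bsub>ideals_set R\<^esub> n) \<cdot> I"
    then show "x \<in> (J [^]\<^bsub>ideals_set R\<^esub> n) \<cdot> J"
      by (induction x rule: ideal_prod.induct) (use Suc in \<open>auto intro: ideal_prod.intros\<close>)
  qed
qed (simp add: ideal_power_0)

lemma ideal_integral_closure_mono: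
  "I \<subseteq> J \<Longrightarrow> ideal_integral_closure R I \<subseteq> ideal_integral_closure R J"
  unfolding ideal_integral_closure_def using ideal_power_mono by blast

lemma ideal_power_mult_stable:
  assumes I: "ideal I R" and M: "ideal M R" and c: "c \<in> carrier R"
    and red: "\<And>u. u \<in> I \<Longrightarrow> (\<otimes>) u ` M \<subseteq> (\<otimes>) c ` M"
    and "x \<in> I [^]\<^bsub>ideals_set R\<^esub> (n::nat)"
  shows "(\<otimes>) x ` M \<subseteq> (\<otimes>) (c [^] n) ` M"
  using assms(5)
proof (induction n arbitrary: x)
  case 0
  then have "x \<in> carrier R"
    unfolding ideal_power_0 .
  then have "x \<otimes> v \<in> M" if "v \<in> M" for v
    using ideal.I_l_closed[OF M that] by simp
  moreover have "v = \<one> \<otimes> v" if "v \<in> M" for v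
    using ideal.Icarr[OF M that] by simp
  ultimately show ?case
    by (auto intro!: image_eqI)
next
  case (Suc n)
  note In = ideal_power_ideal[OF I, of n]
  show ?case
  proof (rule image_subsetI)
    fix v assume v: "v \<in> M"
    have vR: "v \<in> carrier R"
      using ideal.Icarr[OF M v] .
    have K: "ideal ((\<otimes>) (c [^] Suc n) ` M) R"
      by (rule scaled_ideal[OF M]) (use c in simp)
    have "v \<otimes> x \<in> (\<otimes>) (c [^] Suc n) ` M"
    proof (rule ideal_prod_mult_closed[OF In I K vR])
      show "x \<in> (I [^]\<^bsub>ideals_set R\<^esub> n) \<cdot> I"
        using Suc.prems by (simp only: ideal_power_Suc)
      fix p q assume pq: "p \<in> I [^]\<^bsub>ideals_set R\<^esub> n" "q \<in> I"
      have R: "p \<in> carrier R" "q \<in> carrier R"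
        using ideal.Icarr[OF In pq(1)] ideal.Icarr[OF I pq(2)] .
      obtain v1 where v1: "v1 \<in> M" "q \<otimes> v = c \<otimes> v1"
        using red[OF pq(2)] v by blast
      obtain v2 where v2: "v2 \<in> M" "p \<otimes> v1 = c [^] n \<otimes> v2"
        using Suc.IH[OF pq(1)] v1 by blast
      note vR' = ideal.Icarr[OF M v1(1)] ideal.Icarr[OF M v2(1)]
      have "v \<otimes> (p \<otimes> q) = p \<otimes> (q \<otimes> v)"
        using R vR by (simp add: m_ac)
      also have "\<dots> = c \<otimes> (p \<otimes> v1)"
        unfolding v1(2) using R vR' c by (simp add: m_lcomm)
      also have "\<dots> = c [^] Suc n \<otimes> v2"
        unfolding v2(2) using vR' c by (simp add: m_ac)
      finally show "v \<otimes> (p \<otimes> q) \<in> (\<otimes>) (c [^] Suc n) ` M"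
        using v2(1) by blast
    qed
    moreover have "x \<in> carrier R"
      using ideal.Icarr[OF ideal_power_ideal[OF I] Suc.prems] .
    ultimately show "x \<otimes> v \<in> (\<otimes>) (c [^] Suc n) ` M"
      using vR by (simp add: m_comm)
  qed
qed

text \<open>
  In \<open>y\<^sup>n + a\<^sub>1 y\<^sup>n\<^sup>-\<^sup>1 + \<dots> + a\<^sub>n = 0\<close> with \<open>a\<^sub>i \<in> I\<^sup>i\<close> each fraction \<open>a\<^sub>i/c\<^sup>i\<close> multiplies \<open>M\<close> into itself, so
  \<open>y/c\<close> multiplies \<open>M + (y/c) M + \<dots> + (y/c)\<^sup>n\<^sup>-\<^sup>1 M\<close> into itself.  Multiplying this module by
  \<open>c\<^sup>n\<^sup>-\<^sup>1\<close> turns it into the ideal \<open>N\<close>.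
\<close>
lemma integral_element_stable_ideal:
  assumes I: "ideal I R" and M: "regular_ideal M" and c: "c \<in> nonzerodivisors R"
    and red: "\<And>u. u \<in> I \<Longrightarrow> (\<otimes>) u ` M \<subseteq> (\<otimes>) c ` M"
    and y: "y \<in> ideal_integral_closure R I"
  obtains N where "regular_ideal N" "(\<otimes>) y ` N \<subseteq> (\<otimes>) c ` N"
proof -
  have MI: "ideal M R"
    by (rule regular_ideal_ideal[OF M])
  have cR: "c \<in> carrier R"
    by (rule nonzerodivisor_carrier[OF c])
  obtain n :: nat and a where yR: "y \<in> carrier R" and n: "n \<ge> 1"
    and a: "\<And>i. i \<in> {1..n} \<Longrightarrow> a i \<in> I [^]\<^bsub>ideals_set R\<^esub> i"
    and eq: "y [^] n \<oplus> (\<Oplus>i\<in>{1..n}. a i \<otimes> y [^] (n - i)) = \<zero>"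
    using y unfolding ideal_integral_closure_def by blast
  have aR: "a i \<in> carrier R" if "i \<in> {1..n}" for i
    using ideal.Icarr[OF ideal_power_ideal[OF I] a[OF that]] .
  define G where "G = {y [^] j \<otimes> (c [^] (n - 1 - j) \<otimes> v) | j v. j < n \<and> v \<in> M}"
  have GR: "G \<subseteq> carrier R"
    unfolding G_def using yR cR ideal.Icarr[OF MI] by auto
  define N where "N = Idl G"
  have N: "ideal N R"
    unfolding N_def by (rule genideal_ideal[OF GR])
  have cN: "ideal ((\<otimes>) c ` N) R"
    by (rule scaled_ideal[OF N cR])
  have gen: "c \<otimes> (y [^] j \<otimes> (c [^] (n - 1 - j) \<otimes> v)) \<in> (\<otimes>) c ` N" if "j < n" "v \<in> M" for j v
    using genideal_self[OF GR] that unfolding N_def G_def by blast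
  have "y \<otimes> g \<in> (\<otimes>) c ` N" if "g \<in> G" for g
  proof -
    obtain j v where j: "j < n" "v \<in> M" and g: "g = y [^] j \<otimes> (c [^] (n - 1 - j) \<otimes> v)"
      using \<open>g \<in> G\<close> unfolding G_def by blast
    have vR: "v \<in> carrier R"
      using ideal.Icarr[OF MI j(2)] .
    show ?thesis
    proof (cases "Suc j < n")
      case True
      then have exp: "n - 1 - j = Suc (n - 1 - Suc j)"
        by simp
      have "y \<otimes> g = c \<otimes> (y [^] Suc j \<otimes> (c [^] (n - 1 - Suc j) \<otimes> v))"
        unfolding g exp using yR cR vR by (simp add: m_ac)
      then show ?thesis
        using gen[OF True j(2)] by simp
    next
      case False
      then have j_eq: "n = Suc j"
        using j(1) by simp
      let ?s = "\<Oplus>i\<in>{1..n}. a i \<otimes> y [^] (n - i)"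
      have sR: "?s \<in> carrier R"
        using aR yR by (auto intro!: finsum_closed)
      have "y \<otimes> g = y [^] n \<otimes> v"
        unfolding g j_eq using yR vR by (simp add: m_ac)
      also have "y [^] n = \<ominus> ?s"
        by (rule minus_equality[OF eq sR, symmetric]) (use yR in simp)
      also have "(\<ominus> ?s) \<otimes> v = \<ominus> (v \<otimes> ?s)"
        using sR vR by (simp add: l_minus r_minus m_comm)
      also have "v \<otimes> ?s = (\<Oplus>i\<in>{1..n}. v \<otimes> (a i \<otimes> y [^] (n - i)))"
        using aR yR vR by (intro finsum_rdistr) auto
      also have "\<ominus> \<dots> \<in> (\<otimes>) c ` N"
      proof (rule ideal_a_inv[OF cN ideal_finsum[OF cN]])
        fix i assume i: "i \<in> {1..n}"
        obtain w where w: "w \<in> M" "a i \<otimes> v = c [^] i \<otimes> w"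
          using ideal_power_mult_stable[OF I MI cR red a[OF i]] j(2) by blast
        have wR: "w \<in> carrier R"
          using ideal.Icarr[OF MI w(1)] .
        obtain k where k: "i = Suc k"
          using i by (cases i) auto
        have exp: "n - 1 - (n - i) = k"
          using i k by auto
        have c_pow: "c [^] i = c [^] k \<otimes> c"
          by (simp add: k)
        have "v \<otimes> (a i \<otimes> y [^] (n - i)) = y [^] (n - i) \<otimes> (a i \<otimes> v)"
          using vR aR[OF i] yR by (simp add: m_ac)
        also have "\<dots> = c \<otimes> (y [^] (n - i) \<otimes> (c [^] k \<otimes> w))"
          unfolding w(2) c_pow using yR cR wR by (simp add: m_ac)
        also have "\<dots> \<in> (\<otimes>) c ` N"
          using gen[of "n - i" w] i w(1) exp by auto
        finally show "v \<otimes> (a i \<otimes> y [^] (n - i)) \<in> (\<otimes>) c ` N" .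
      qed simp
      finally show ?thesis .
    qed
  qed
  then have "(\<otimes>) y ` N \<subseteq> (\<otimes>) c ` N"
    using Idl_mult_closed[OF cN GR yR] unfolding N_def by blast
  moreover have "regular_ideal N"
  proof -
    obtain g where g: "g \<in> M" "g \<in> nonzerodivisors R"
      using M by (auto simp: regular_ideal_def)
    then have "c [^] (n - 1) \<otimes> g \<in> G"
      unfolding G_def using n cR ideal.Icarr[OF MI g(1)]
      by (intro CollectI exI[of _ "0::nat"] exI[of _ g]) auto
    then have "c [^] (n - 1) \<otimes> g \<in> N"
      unfolding N_def using genideal_self[OF GR] by blast
    moreover have "c [^] (n - 1) \<otimes> g \<in> nonzerodivisors R"
      by (intro nonzerodivisor_mult nonzerodivisor_pow c g)
    ultimately show ?thesis
      unfolding regular_ideal_def using N by blast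
  qed
  ultimately show thesis
    using that by blast
qed

end

text \<open>
  Starting from a nonzerodivisor \<open>w\<^sub>0 = g \<in> N\<close>, choose \<open>w\<^sub>i \<in> N\<close> with \<open>y w\<^sub>i = c w\<^sub>i\<^sub>+\<^sub>1\<close>; they stand for the
  elements \<open>(y/c)\<^sup>i g\<close>.  A relation expressing one of them through the earlier ones can be divided
  by \<open>g\<close> after clearing denominators.
\<close>
lemma (in noetherian_cring) stable_ideal_imp_integral_fraction:
  assumes N: "regular_ideal N" and c: "c \<in> carrier R" and y: "y \<in> carrier R"
    and stable: "(\<otimes>) y ` N \<subseteq> (\<otimes>) c ` N"
  shows "integral_fraction y c"
proof -
  have NI: "ideal N R"
    by (rule regular_ideal_ideal[OF N])
  obtain g where g: "g \<in> N" "g \<in> nonzerodivisors R"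
    using N by (auto simp: regular_ideal_def)
  have gR: "g \<in> carrier R"
    using ideal.Icarr[OF NI g(1)] .
  have "\<forall>v\<in>N. \<exists>w\<in>N. y \<otimes> v = c \<otimes> w"
    using stable by blast
  then obtain f where f: "\<And>v. v \<in> N \<Longrightarrow> f v \<in> N" "\<And>v. v \<in> N \<Longrightarrow> y \<otimes> v = c \<otimes> f v"
    by metis
  define w where "w i = (f ^^ i) g" for i
  have w: "w i \<in> N" for i
    unfolding w_def by (induction i) (use g f in auto)
  have wR: "w i \<in> carrier R" for i
    using ideal.Icarr[OF NI w] .
  have w_pow: "y [^] i \<otimes> g = c [^] i \<otimes> w i" for i
  proof (induction i)
    case 0
    then show ?case by (simp add: w_def)
  next
    case (Suc i)
    have "y [^] Suc i \<otimes> g = y \<otimes> (y [^] i \<otimes> g)"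
      using y gR by (simp add: m_ac)
    also have "\<dots> = c [^] i \<otimes> (y \<otimes> w i)"
      unfolding Suc.IH using y c wR by (simp add: m_lcomm)
    also have "y \<otimes> w i = c \<otimes> w (Suc i)"
      using f(2)[OF w] by (simp add: w_def)
    also have "c [^] i \<otimes> (c \<otimes> w (Suc i)) = c [^] Suc i \<otimes> w (Suc i)"
      using c wR by (simp add: m_assoc)
    finally show ?case .
  qed
  obtain r n where r: "\<And>i. r i \<in> carrier R" "w n = (\<Oplus>i\<in>{..<n}. r i \<otimes> w i)"
    by (rule sequence_eventually_dependent[of w, OF wR]) (rule that)
  have eq: "g \<otimes> y [^] n = g \<otimes> (\<Oplus>i\<in>{..<n}. (r i \<otimes> c [^] (n - i)) \<otimes> y [^] i)"
  proof -
    have "g \<otimes> y [^] n = c [^] n \<otimes> w n"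
      using w_pow[of n] y gR by (simp add: m_comm)
    also have "\<dots> = (\<Oplus>i\<in>{..<n}. c [^] n \<otimes> (r i \<otimes> w i))"
      unfolding r(2) using c r(1) wR by (intro finsum_rdistr) auto
    also have "\<dots> = (\<Oplus>i\<in>{..<n}. g \<otimes> ((r i \<otimes> c [^] (n - i)) \<otimes> y [^] i))"
    proof (rule finsum_cong')
      fix i assume "i \<in> {..<n}"
      then have "c [^] n = c [^] (n - i) \<otimes> c [^] i"
        using c by (simp add: nat_pow_mult)
      then have "c [^] n \<otimes> (r i \<otimes> w i) = (r i \<otimes> c [^] (n - i)) \<otimes> (c [^] i \<otimes> w i)"
        using c r(1) wR by (simp add: m_ac)
      also have "\<dots> = g \<otimes> ((r i \<otimes> c [^] (n - i)) \<otimes> y [^] i)"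
        unfolding w_pow[symmetric] using c r(1) gR y by (simp add: m_ac)
      finally show "c [^] n \<otimes> (r i \<otimes> w i) = g \<otimes> ((r i \<otimes> c [^] (n - i)) \<otimes> y [^] i)" .
    qed (use c r(1) gR y in auto)
    also have "\<dots> = g \<otimes> (\<Oplus>i\<in>{..<n}. (r i \<otimes> c [^] (n - i)) \<otimes> y [^] i)"
      using c r(1) gR y by (intro finsum_rdistr[symmetric]) auto
    finally show ?thesis .
  qed
  have relation: "y [^] n = (\<Oplus>i\<in>{..<n}. (r i \<otimes> c [^] (n - i)) \<otimes> y [^] i)"
    by (rule nonzerodivisor_cancel[OF g(2) _ _ eq]) (use c r(1) y in \<open>auto intro!: finsum_closed\<close>)
  show ?thesis
  proof (cases "n = 0")
    case True
    \<comment> \<open>An empty relation means \<open>1 = 0\<close>.\<close>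
    then have "\<one> = \<zero>"
      using relation by simp
    then have trivial: "x = \<zero>" if "x \<in> carrier R" for x
      using that by (metis l_null l_one)
    have "y [^] (1::nat) \<oplus> (\<Oplus>i\<in>{1..1::nat}. (\<zero> \<otimes> c [^] i) \<otimes> y [^] (1 - i)) = \<zero>"
      by (rule trivial) (use y c in \<open>auto intro!: a_closed finsum_closed\<close>)
    then show ?thesis
      unfolding integral_fraction_def
      by (intro exI[of _ "1::nat"] exI[of _ "\<lambda>_. \<zero>"] conjI) auto
  next
    case False
    define h where "h i = (r i \<otimes> c [^] (n - i)) \<otimes> y [^] i" for i
    have h: "h i \<in> carrier R" for i
      unfolding h_def using r(1) c y by simp
    have bij: "bij_betw (\<lambda>i. n - i) {1..n} {..<n}"
      by (rule bij_betw_byWitness[where f' = "\<lambda>i. n - i"]) auto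
    have "(\<Oplus>i\<in>{1..n}. (\<ominus> r (n - i) \<otimes> c [^] i) \<otimes> y [^] (n - i)) = (\<Oplus>i\<in>{1..n}. (\<ominus> \<one>) \<otimes> h (n - i))"
      unfolding h_def using r(1) c y by (intro finsum_cong') (auto simp: l_minus)
    also have "\<dots> = (\<ominus> \<one>) \<otimes> (\<Oplus>i\<in>{1..n}. h (n - i))"
      using h by (intro finsum_rdistr[symmetric]) auto
    also have "(\<Oplus>i\<in>{1..n}. h (n - i)) = (\<Oplus>i\<in>{..<n}. h i)"
      using finsum_reindex[of h "\<lambda>i. n - i" "{1..n}"] bij h by (auto simp: bij_betw_def)
    also have "\<dots> = y [^] n"
      unfolding h_def relation ..
    finally have "y [^] n \<oplus> (\<Oplus>i\<in>{1..n}. (\<ominus> r (n - i) \<otimes> c [^] i) \<otimes> y [^] (n - i)) = \<zero>"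
      using y by (simp add: l_minus r_neg)
    then show ?thesis
      unfolding integral_fraction_def using False r(1)
      by (intro exI[of _ n] conjI exI[of _ "\<lambda>i. \<ominus> r (n - i)"]) auto
  qed
qed

section \<open>The conductor and the intersection of colon ideals\<close>

context cring
begin

lemma ideal_integral_closure_carrier: "ideal_integral_closure R I \<subseteq> carrier R"
  by (auto simp: ideal_integral_closure_def)

lemma tau_ideal_ideal: "ideal (tau_ideal R) R"
  unfolding tau_ideal_def
  using oneideal
  by (intro i_Intersect) (auto intro!: ideal_colon_ideal ideal_integral_closure_carrier)

lemma tau_ideal_mult:
  "\<lbrakk>r \<in> tau_ideal R; ideal I R; y \<in> ideal_integral_closure R I\<rbrakk> \<Longrightarrow> r \<otimes> y \<in> I"
  by (auto simp: tau_ideal_def ideal_colon_def)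

text \<open>
  If \<open>y/c\<close> satisfies an equation with coefficients \<open>a\<^sub>i\<close>, then \<open>y\<close> satisfies one with coefficients
  \<open>a\<^sub>i c\<^sup>i \<in> (c)\<^sup>i\<close>; so \<open>y\<close> is integral over the ideal \<open>(c)\<close>.
\<close>
lemma tau_ideal_subset_conductor: "tau_ideal R \<subseteq> conductor R"
proof
  fix r assume r: "r \<in> tau_ideal R"
  have "r \<otimes> y \<in> (\<otimes>) c ` carrier R"
    if y: "y \<in> carrier R" and c: "c \<in> nonzerodivisors R" and "integral_fraction y c" for y c
  proof -
    have cR: "c \<in> carrier R"
      using c by (rule nonzerodivisor_carrier)
    have P: "ideal (PIdl c) R"
      by (rule cgenideal_ideal[OF cR])
    obtain n :: nat and a where n: "n \<ge> 1" and a: "\<forall>i\<in>{1..n}. a i \<in> carrier R"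
      and eq: "y [^] n \<oplus> (\<Oplus>i\<in>{1..n}. (a i \<otimes> c [^] i) \<otimes> y [^] (n - i)) = \<zero>"
      using \<open>integral_fraction y c\<close> unfolding integral_fraction_def by blast
    have "\<forall>i\<in>{1..n}. a i \<otimes> c [^] i \<in> PIdl c [^]\<^bsub>ideals_set R\<^esub> i"
    proof
      fix i assume "i \<in> {1..n}"
      then show "a i \<otimes> c [^] i \<in> PIdl c [^]\<^bsub>ideals_set R\<^esub> i"
        using ideal.I_l_closed[OF ideal_power_ideal[OF P]
            pow_mem_ideal_power[OF cgenideal_self[OF cR]]] a by blast
    qed
    then have "y \<in> ideal_integral_closure R (PIdl c)"
      unfolding ideal_integral_closure_def using y n eq
      by (intro CollectI conjI exI[of _ n] exI[of _ "\<lambda>i. a i \<otimes> c [^] i"]) auto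
    then have "r \<otimes> y \<in> PIdl c"
      by (rule tau_ideal_mult[OF r P])
    then show ?thesis
      using cR by (auto simp: cgenideal_def m_comm[of _ c])
  qed
  moreover have "r \<in> carrier R"
    using r ideal.Icarr[OF tau_ideal_ideal] by blast
  ultimately show "r \<in> conductor R"
    by (simp add: mem_conductor_iff)
qed

text \<open>
  The equation \<open>z\<^sup>2 = 0\<close> makes \<open>z\<close> integral over the zero ideal.
\<close>
lemma nilpotent_imp_tau_ideal_proper:
  assumes "z \<in> carrier R" "z \<noteq> \<zero>" "z \<otimes> z = \<zero>"
  shows "tau_ideal R \<noteq> carrier R"
proof
  assume "tau_ideal R = carrier R"
  have "\<zero> \<in> {\<zero>} [^]\<^bsub>ideals_set R\<^esub> i" for i :: nat
    by (rule ideal_zero[OF ideal_power_ideal[OF zeroideal]])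
  moreover have "z [^] (2::nat) \<oplus> (\<Oplus>i\<in>{1..2::nat}. \<zero> \<otimes> z [^] (2 - i)) = \<zero>"
  proof -
    have "(\<Oplus>i\<in>{1..2::nat}. \<zero> \<otimes> z [^] (2 - i)) = (\<Oplus>i\<in>{1..2::nat}. \<zero>)"
      using assms(1) by (intro finsum_cong') auto
    then show ?thesis
      using assms by (simp add: numeral_2_eq_2)
  qed
  ultimately have "z \<in> ideal_integral_closure R {\<zero>}"
    unfolding ideal_integral_closure_def using assms(1)
    by (intro CollectI conjI exI[of _ "2::nat"] exI[of _ "\<lambda>_. \<zero>"]) auto
  then have "\<one> \<otimes> z \<in> {\<zero>}"
    using tau_ideal_mult[OF _ zeroideal] \<open>tau_ideal R = carrier R\<close> by blast
  then show False
    using assms by simp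
qed

end

text \<open>
  Principal reductions are available for ideals containing a nonzerodivisor.  The ideals
  \<open>I + (d\<^sup>n)\<close> have this property, and they intersect in \<open>I\<close>.
\<close>
lemma (in noetherian_local_ring_dim_le_one) conductor_subset_tau_ideal:
  assumes d: "d \<in> \<mm>" "d \<in> nonzerodivisors R" and inf: "infinite (carrier (R Quot \<mm>))"
  shows "conductor R \<subseteq> tau_ideal R"
proof
  fix r assume r: "r \<in> conductor R"
  have rR: "r \<in> carrier R"
    using r by (simp add: mem_conductor_iff)
  have regular: "r \<otimes> y \<in> J"
    if J: "regular_ideal J" and y: "y \<in> ideal_integral_closure R J" for J y
  proof (cases "J = carrier R")
    case True
    then show ?thesis
      using rR y ideal_integral_closure_carrier by blast
  next
    case False
    have JI: "ideal J R"
      by (rule regular_ideal_ideal[OF J])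
    obtain c M where c: "c \<in> J" "c \<in> nonzerodivisors R" and M: "regular_ideal M"
      "\<And>u. u \<in> J \<Longrightarrow> (\<otimes>) u ` M \<subseteq> (\<otimes>) c ` M"
      by (rule principal_reduction[OF J False inf]) (rule that)
    obtain N where "regular_ideal N" "(\<otimes>) y ` N \<subseteq> (\<otimes>) c ` N"
      by (rule integral_element_stable_ideal[OF JI M(1) c(2) M(2) y])
    then have "integral_fraction y c"
      using stable_ideal_imp_integral_fraction nonzerodivisor_carrier[OF c(2)] y
        ideal_integral_closure_carrier by blast
    then have "r \<otimes> y \<in> (\<otimes>) c ` carrier R"
      using r y c(2) ideal_integral_closure_carrier unfolding mem_conductor_iff by blast
    then show ?thesis
      using ideal.I_r_closed[OF JI c(1)] by auto
  qed
  have dR: "d \<in> carrier R"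
    by (rule nonzerodivisor_carrier[OF d(2)])
  have "r \<otimes> y \<in> I" if I: "ideal I R" and y: "y \<in> ideal_integral_closure R I" for I y
  proof -
    have wR: "r \<otimes> y \<in> carrier R"
      using rR y ideal_integral_closure_carrier by auto
    have "r \<otimes> y \<in> I <+>\<^bsub>R\<^esub> PIdl (d [^] n)" for n :: nat
    proof -
      have dn: "d [^] n \<in> carrier R"
        using dR by simp
      note P = cgenideal_ideal[OF dn]
      note upper = ideal_sum_upper[OF I P]
      have "regular_ideal (I <+>\<^bsub>R\<^esub> PIdl (d [^] n))"
        unfolding regular_ideal_def
        using add_ideals[OF I P] upper(2) cgenideal_self[OF dn] nonzerodivisor_pow[OF d(2)] by blast
      then show ?thesis
        using regular ideal_integral_closure_mono[OF upper(1)] y by blast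
    qed
    then obtain b where b: "b \<in> carrier R" "r \<otimes> y \<ominus> (d \<otimes> b) \<otimes> (r \<otimes> y) \<in> I"
      by (rule principal_krull_intersection[OF I dR wR])
    have "r \<otimes> y \<ominus> (d \<otimes> b) \<otimes> (r \<otimes> y) = (\<one> \<ominus> d \<otimes> b) \<otimes> (r \<otimes> y)"
      using wR dR b(1) by (simp add: a_minus_def l_distr l_minus)
    moreover have "\<one> \<ominus> d \<otimes> b \<notin> \<mm>"
      using outside_max_minus one_notin_max I_r_closed[OF d(1) b(1)] by blast
    ultimately show ?thesis
      using cancel_outside_max[OF I _ _ wR, of "\<one> \<ominus> d \<otimes> b"] b dR by simp
  qed
  then show "r \<in> tau_ideal R"
    using rR by (auto simp: tau_ideal_def ideal_colon_def)
qed

section \<open>Depth zero\<close>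

context noetherian_local_ring
begin

text \<open>
  Suppose that \<open>R\<close> is reduced, and choose \<open>a \<in> \<mm>\<close> with smallest annihilator; this is possible because
  the annihilators of annihilators satisfy the ascending chain condition.  Let \<open>b \<in> \<mm>\<close> with
  \<open>b a = 0\<close>.  If \<open>c (a + b) = 0\<close>, then \<open>(c a)\<^sup>2 = 0\<close>, hence \<open>c a = 0\<close>.  By minimality \<open>a + b\<close> and \<open>a\<close> have
  the same annihilator; so \<open>b (a + b) = 0\<close>, which gives \<open>b\<^sup>2 = 0\<close> and \<open>b = 0\<close>.  Being a zero divisor,
  \<open>a\<close> is therefore killed by a unit.  Thus \<open>a = 0\<close>, and every \<open>b \<in> \<mm>\<close> vanishes.
\<close>
lemma depth_zero_imp_nilpotent:
  assumes zero_div: "\<And>x. x \<in> \<mm> \<Longrightarrow> x \<notin> nonzerodivisors R" and "\<mm> \<noteq> {\<zero>}"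
  obtains z where "z \<in> carrier R" "z \<noteq> \<zero>" "z \<otimes> z = \<zero>"
proof -
  have "\<exists>z\<in>carrier R. z \<noteq> \<zero> \<and> z \<otimes> z = \<zero>"
  proof (rule ccontr)
    assume "\<not> ?thesis"
    then have reduced: "z = \<zero>" if "z \<in> carrier R" "z \<otimes> z = \<zero>" for z
      using that by blast
    define ann where "ann a = ideal_colon R {\<zero>} {a}" for a
    have mem_ann: "b \<in> ann a \<longleftrightarrow> b \<in> carrier R \<and> b \<otimes> a = \<zero>" for a b
      by (auto simp: ann_def ideal_colon_def)
    define ann2 where "ann2 a = ideal_colon R {\<zero>} (ann a)" for a
    have mem_ann2: "x \<in> ann2 a \<longleftrightarrow> x \<in> carrier R \<and> (\<forall>b\<in>ann a. x \<otimes> b = \<zero>)" for a x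
      by (auto simp: ann2_def ideal_colon_def)
    have ann2: "ideal (ann2 a) R" for a
      unfolding ann2_def by (rule ideal_colon_ideal[OF zeroideal]) (auto simp: mem_ann)
    obtain M where M: "M \<in> ann2 ` \<mm>" "\<And>J. \<lbrakk>J \<in> ann2 ` \<mm>; M \<subseteq> J\<rbrakk> \<Longrightarrow> J = M"
      by (rule maximal_ideal_of_family[of "ann2 ` \<mm>"]) (use ann2 ideal_zero[OF max_ideal] in blast)+
    then obtain a where a: "a \<in> \<mm>" "M = ann2 a"
      by blast
    have aR: "a \<in> carrier R"
      using Icarr[OF a(1)] .
    have small: "b = \<zero>" if b: "b \<in> \<mm>" "b \<otimes> a = \<zero>" for b
    proof -
      have bR: "b \<in> carrier R"
        using Icarr[OF b(1)] .
      have "ann (a \<oplus> b) \<subseteq> ann a"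
      proof
        fix c assume "c \<in> ann (a \<oplus> b)"
        then have c: "c \<in> carrier R" "c \<otimes> (a \<oplus> b) = \<zero>"
          by (auto simp: mem_ann)
        have "(c \<otimes> a) \<otimes> (c \<otimes> a) = (c \<otimes> a) \<otimes> (c \<otimes> (a \<oplus> b)) \<ominus> (c \<otimes> c) \<otimes> (b \<otimes> a)"
        proof -
          have "(c \<otimes> a) \<otimes> (c \<otimes> (a \<oplus> b)) = (c \<otimes> c) \<otimes> (b \<otimes> a) \<oplus> (c \<otimes> a) \<otimes> (c \<otimes> a)"
            using c(1) aR bR by (simp add: r_distr m_ac a_ac)
          then show ?thesis
            using c(1) aR bR by (simp add: add_minus_cancel_left)
        qed
        also have "\<dots> = \<zero>"
          unfolding c(2) b(2) using c(1) aR by (simp add: a_minus_def)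
        finally show "c \<in> ann a"
          using reduced[of "c \<otimes> a"] c(1) aR by (simp add: mem_ann)
      qed
      then have "ann2 a \<subseteq> ann2 (a \<oplus> b)"
        unfolding mem_ann2 subset_iff by blast
      then have "ann2 (a \<oplus> b) = ann2 a"
        using M(2) a ideal_add[OF max_ideal a(1) b(1)] by blast
      moreover have "a \<oplus> b \<in> ann2 (a \<oplus> b)"
        using aR bR by (auto simp: mem_ann2 mem_ann m_comm[of "a \<oplus> b"])
      ultimately have "(a \<oplus> b) \<otimes> b = \<zero>"
        using b(2) bR by (auto simp: mem_ann2 mem_ann)
      then have "b \<otimes> a \<oplus> b \<otimes> b = \<zero>"
        using aR bR by (simp add: l_distr m_comm[of a b])
      then show ?thesis
        using reduced[OF bR] b(2) bR by simp
    qed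
    obtain s where s: "s \<in> carrier R" "s \<noteq> \<zero>" "a \<otimes> s = \<zero>"
      using zero_div[OF a(1)] aR by (auto simp: nonzerodivisors_def)
    then have "s \<notin> \<mm>"
      using small[of s] aR by (auto simp: m_comm)
    moreover have "s \<otimes> a \<in> {\<zero>}"
      using s aR by (simp add: m_comm)
    ultimately have "a \<in> {\<zero>}"
      using cancel_outside_max[OF zeroideal s(1) _ aR] by blast
    then have "b = \<zero>" if "b \<in> \<mm>" for b
      using small[OF that] Icarr[OF that] by simp
    then show False
      using assms(2) ideal_zero[OF max_ideal] by blast
  qed
  then show thesis
    using that by blast
qed

lemma depth_zero_imp_conductor_eq_carrier:
  assumes "\<And>x. x \<in> \<mm> \<Longrightarrow> x \<notin> nonzerodivisors R"
  shows "conductor R = carrier R"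
proof -
  have "x \<in> (\<otimes>) c ` carrier R" if c: "c \<in> nonzerodivisors R" and x: "x \<in> carrier R" for c x
  proof -
    have cR: "c \<in> carrier R"
      by (rule nonzerodivisor_carrier[OF c])
    obtain v where v: "v \<in> carrier R" "v \<otimes> c = \<one>"
      using invertible_outside_max[OF cR] assms c by blast
    have "c \<otimes> (v \<otimes> x) = (v \<otimes> c) \<otimes> x"
      using v(1) cR x by (simp add: m_ac)
    then have "x = c \<otimes> (v \<otimes> x)"
      using v x by simp
    then show ?thesis
      using v(1) x by blast
  qed
  then show ?thesis
    by (auto simp: mem_conductor_iff)
qed

lemma krull_dim_pos_imp_max_nonzero:
  assumes "krull_dim R \<noteq> 0"
  shows "\<mm> \<noteq> {\<zero>}"
proof
  assume zero: "\<mm> = {\<zero>}"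
  have prime: "P = {\<zero>}" if P: "primeideal P R" for P
    using proper_ideal_subset_max[OF primeideal.axioms(1)[OF P]] primeideal.I_notcarr[OF P]
      ideal_zero[OF primeideal.axioms(1)[OF P]] zero by auto
  have "n = 0" if P: "\<forall>i\<le>n. primeideal (P i) R" "\<forall>i<n. P i \<subset> P (Suc i)" for n :: nat and P
  proof (rule ccontr)
    assume "n \<noteq> 0"
    then have "P 0 = {\<zero>}" "P 1 = {\<zero>}" "P 0 \<subset> P 1"
      using prime P by (auto simp: Suc_le_eq)
    then show False by simp
  qed
  then have "krull_dim R \<le> 0"
    unfolding krull_dim_def by (intro Sup_least) (auto simp: zero_enat_def)
  then show False
    using assms by simp
qed

end

section \<open>Cohen-Macaulay rings of dimension one\<close>

lemma (in cring) coset_nonzerodivisor_iff: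
  assumes I: "ideal I R" and x: "x \<in> carrier R"
  shows "I +> x \<in> nonzerodivisors (R Quot I) \<longleftrightarrow> (\<forall>r\<in>carrier R. x \<otimes> r \<in> I \<longrightarrow> r \<in> I)"
proof -
  interpret I: ideal I R by (rule I)
  have zero: "I +> z = I \<longleftrightarrow> z \<in> I" if "z \<in> carrier R" for z
    using a_rcos_zero[OF I] I.rcos_const_imp_mem[OF that] by blast
  have carr: "carrier (R Quot I) = (\<lambda>z. I +> z) ` carrier R"
    by (auto simp: FactRing_def A_RCOSETS_def')
  show ?thesis
    unfolding nonzerodivisors_def carr
    using x by (auto simp: FactRing_def I.rcoset_mult_add zero)
qed

context noetherian_local_ring_dim_le_one
begin

lemma regular_sequence_head:
  assumes "regular_sequence R (x # xs)"
  shows "x \<in> nonzerodivisors R"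
proof -
  have x: "x \<in> carrier R" and "Idl {} +> x \<in> nonzerodivisors (R Quot (Idl {}))"
    using assms by (auto simp: regular_sequence_def)
  moreover have "ideal (Idl {}) R"
    by (rule genideal_ideal) simp
  moreover have "Idl {} = {\<zero>}"
    using genideal_minimal[OF zeroideal, of "{}"] ideal_zero[OF genideal_ideal, of "{}"] by blast
  ultimately show ?thesis
    using coset_nonzerodivisor_iff[of "Idl {}" x] by (auto simp: nonzerodivisors_def)
qed

text \<open>
  Modulo \<open>x\<close> all of \<open>\<mm>\<close> annihilates a common nonzero element, so \<open>\<mm>\<close> contains no second term.
\<close>
lemma regular_sequence_length:
  assumes "regular_sequence R xs" "set xs \<subseteq> \<mm>"
  shows "length xs \<le> 1"
proof (rule ccontr)
  assume "\<not> length xs \<le> 1"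
  then obtain x y ys where xs: "xs = x # y # ys"
    by (cases xs; cases "tl xs") auto
  have x: "x \<in> nonzerodivisors R"
    using regular_sequence_head assms(1) xs by blast
  have xy: "x \<in> \<mm>" "y \<in> \<mm>" "x \<in> carrier R" "y \<in> carrier R"
    using assms xs by (auto simp: regular_sequence_def)
  let ?D = "Idl {x}"
  have D: "ideal ?D R"
    by (rule genideal_ideal) (use xy in auto)
  have "?D \<subseteq> \<mm>"
    by (rule genideal_minimal[OF max_ideal]) (use xy in auto)
  then have "?D \<noteq> carrier R"
    using one_notin_max by auto
  then obtain z where z: "z \<in> carrier R" "z \<notin> ?D" "ideal_colon R ?D {z} = \<mm>"
    using regular_ideal_socle[OF D _ genideal_self'[OF xy(3)] x] by blast
  have "?D +> y \<in> nonzerodivisors (R Quot ?D)"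
    using assms(1) xs by (auto simp: regular_sequence_def dest!: spec[of _ 1])
  then have "r \<in> ?D" if "r \<in> carrier R" "y \<otimes> r \<in> ?D" for r
    using coset_nonzerodivisor_iff[OF D xy(4)] that by blast
  moreover have "y \<otimes> z \<in> ?D"
    using z(3) xy(2) by (auto simp: ideal_colon_def)
  ultimately show False
    using z by blast
qed

lemma regular_sequence_singleton:
  assumes "x \<in> \<mm>" "x \<in> nonzerodivisors R"
  shows "regular_sequence R [x]"
proof -
  have xR: "x \<in> carrier R"
    using Icarr[OF assms(1)] .
  have I: "ideal (Idl {}) R"
    by (rule genideal_ideal) simp
  have zero: "Idl {} = {\<zero>}"
    using genideal_minimal[OF zeroideal, of "{}"] ideal_zero[OF I] by blast
  have "Idl {} +> x \<in> nonzerodivisors (R Quot (Idl {}))"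
    using coset_nonzerodivisor_iff[OF I xR] nonzerodivisorD[OF assms(2)] zero by auto
  moreover have "Idl {x} \<subseteq> \<mm>"
    by (rule genideal_minimal[OF max_ideal]) (use assms in auto)
  then have "Idl {x} \<noteq> carrier R"
    using one_notin_max by auto
  ultimately show ?thesis
    using xR by (simp add: regular_sequence_def)
qed

lemma cohen_macaulay_iff_regular_element:
  assumes "krull_dim R = 1"
  shows "cohen_macaulay_local R \<mm> \<longleftrightarrow> (\<exists>x\<in>\<mm>. x \<in> nonzerodivisors R)"
proof -
  let ?L = "{enat (length xs) | xs. regular_sequence R xs \<and> set xs \<subseteq> \<mm>}"
  have "local_depth R \<mm> = 1 \<longleftrightarrow> (\<exists>x\<in>\<mm>. x \<in> nonzerodivisors R)"
  proof
    assume depth: "local_depth R \<mm> = 1"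
    show "\<exists>x\<in>\<mm>. x \<in> nonzerodivisors R"
    proof (rule ccontr)
      assume none: "\<not> ?thesis"
      have "xs = []" if "regular_sequence R xs" "set xs \<subseteq> \<mm>" for xs
        using that none regular_sequence_head by (cases xs) auto
      then have "Sup ?L \<le> 0"
        by (intro Sup_least) (auto simp: zero_enat_def)
      then show False
        using depth by (simp add: local_depth_def)
    qed
  next
    assume "\<exists>x\<in>\<mm>. x \<in> nonzerodivisors R"
    then obtain x where x: "x \<in> \<mm>" "x \<in> nonzerodivisors R"
      by blast
    have "enat 1 \<le> Sup ?L"
      using regular_sequence_singleton[OF x] x(1)
      by (intro Sup_upper CollectI exI[of _ "[x]"]) auto
    moreover have "Sup ?L \<le> enat 1"
      using regular_sequence_length by (intro Sup_least) auto
    ultimately show "local_depth R \<mm> = 1"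
      by (simp add: local_depth_def one_enat_def)
  qed
  then show ?thesis
    using assms noetherian_local_ring_axioms by (simp add: cohen_macaulay_local_def)
qed

end

theorem theorem4p4:
  fixes R :: "('a, 'b) ring_scheme" and \<mm> :: "'a set"
  assumes "noetherian_local_ring R \<mm>"
    and "krull_dim R = 1"
    and "infinite (carrier (R Quot \<mm>))"
  shows "(cohen_macaulay_local R \<mm> \<longleftrightarrow> tau_ideal R = conductor R) \<and>
         (\<not> cohen_macaulay_local R \<mm> \<longrightarrow>
            conductor R = carrier R \<and> ideal (tau_ideal R) R \<and> tau_ideal R \<noteq> carrier R)"
proof -
  interpret noetherian_local_ring_dim_le_one R \<mm>
    using assms by (simp add: noetherian_local_ring_dim_le_one_def noetherian_local_ring_dim_le_one_axioms_def)
  show ?thesis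
  proof (cases "cohen_macaulay_local R \<mm>")
    case True
    then obtain d where "d \<in> \<mm>" "d \<in> nonzerodivisors R"
      using cohen_macaulay_iff_regular_element[OF assms(2)] by blast
    then have "tau_ideal R = conductor R"
      using tau_ideal_subset_conductor conductor_subset_tau_ideal assms(3) by blast
    then show ?thesis
      using True by blast
  next
    case False
    then have depth: "x \<notin> nonzerodivisors R" if "x \<in> \<mm>" for x
      using cohen_macaulay_iff_regular_element[OF assms(2)] that by blast
    obtain z where "z \<in> carrier R" "z \<noteq> \<zero>\<^bsub>R\<^esub>" "z \<otimes>\<^bsub>R\<^esub> z = \<zero>\<^bsub>R\<^esub>"
      using depth_zero_imp_nilpotent[OF depth] krull_dim_pos_imp_max_nonzero assms(2) by auto
    then have "tau_ideal R \<noteq> carrier R"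
      by (rule nilpotent_imp_tau_ideal_proper)
    moreover have "conductor R = carrier R"
      by (rule depth_zero_imp_conductor_eq_carrier[OF depth])
    ultimately show ?thesis
      using False tau_ideal_ideal by auto
  qed
qed

end
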